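(* Let $\mathbb K$ be a perfect field of characteristic $p\ge 0$ with algebraic closure $\overline{\mathbb K}$, and let $R=G/H\in \mathbb K(x)$ be a rational function whose $p$-reduction $\tilde R=g/h$ (with $g,h\in\mathbb K[x]$ coprime) has degree $d>1$. Let $d'\ge 0$ be the degree of the polynomial $W=g'h-gh'$, where $'$ denotes the formal derivative. Let $\alpha\in\overline{\mathbb K}$ be an element that is not $R$-critical, and set $e=[\mathbb K(\alpha):\mathbb K]$. Then there exists a constant $c_{\alpha,R}$ with $0<c_{\alpha,R}\le 1$ such that $$\Delta_{\alpha,R}(n)=c_{\alpha,R}\, d^n+O_{\alpha,R}(1)\qquad (n\ge 0),$$ and this constant satisfies the following estimates: (1) If $\alpha$ is not $R$-periodic, then $c_{\alpha,R}\ge \frac{1}{d^2}-\frac{1}{d^3}$. Moreover, (a) if $e>1$, then $c_{\alpha,R}\ge 1-\frac{d'}{de}\ge \frac1d$; (b) if $e=1$ and the set $R^{-\infty}(\alpha)$ does not contain an element $\gamma\in\mathbb K$ with $\deg(G-\gamma H)<\deg(R)$, then $c_{\alpha,R}\ge 1-\frac{\min\{d-1,d'\}}{d}-\frac{d'-\min\{d-1,d'\}}{d^2}\ge \frac{1}{d^2}$. (2) If $\alpha$ is $R$-periodic (of some period $N$), then $c_{\alpha,R}\ge \frac{1}{4d^2}$. Moreover, (a) if $e>2$, then $c_{\alpha,R}\ge 1-\frac{d'}{e(d-1)}\ge \frac13$; (b) if $e=2$, then $c_{\alpha,R}\ge \frac{1}{d^2}-\frac{1}{d^3}$.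
   Context: A rational function $R\in\mathbb K(x)$ is written $R=G/H$ with $G,H\in\mathbb K[x]$ relatively prime; its degree is $\max\{\deg G,\deg H\}$. Iterates: $R^{(0)}(x)=x$ and $R^{(n)}(x)=R^{(n-1)}(R(x))$ for $n\ge1$. The $p$-reduction of $R$: if $p>0$, it is the unique $\tilde R\in\mathbb K(x)$ such that $R=\tilde R^{p^k}$ for some integer $k\ge 0$ and $\tilde R$ is not of the form $R_0^p$ with $R_0\in\mathbb K(x)$; if $p=0$, the $p$-reduction of $R$ is $R$ itself. For $\alpha\in\overline{\mathbb K}$, $\Delta_{\alpha,R}(n)$ denotes the number of distinct solutions $x\in\overline{\mathbb K}$ of $R^{(n)}(x)=\alpha$. The element $\alpha$ is $R$-critical if $\sup_{n\ge0}\Delta_{\alpha,R}(n)<+\infty$. The element $\alpha$ is $R$-periodic if $R^{(N)}(\alpha)=\alpha$ for some integer $N\ge1$; the least such $N$ is its period. The reversed $R$-orbit of $\alpha$ is $R^{-\infty}(\alpha)=\bigcup_{n\ge0}\{\beta\in\overline{\mathbb K}: R^{(n)}(\beta)=\alpha\}$ (it contains $\alpha$). *)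

theory Defs
  imports "HOL-Algebra.Algebraic_Closure_Type"
begin

text \<open>
  The field $K$ is the type \<open>'a\<close>, its algebraic closure is \<open>'a alg_closure\<close> with the embedding
  \<^const>\<open>to_ac\<close>, and $K(x)$ is \<open>'a poly fract\<close>.
\<close>

definition perfect_field :: "'a::field itself \<Rightarrow> bool" where
  "perfect_field _ \<longleftrightarrow> CHAR('a) = 0 \<or> surj (\<lambda>x::'a. x ^ CHAR('a))"

text \<open>
  The representation of a rational function in lowest terms is unique only up to a nonzero
  constant factor, which is fixed here by taking the denominator monic.
\<close>

definition rat_den :: "'a::field poly fract \<Rightarrow> 'a poly" where
  "rat_den R = (THE H. lead_coeff H = 1 \<and> (\<exists>G. coprime G H \<and> R = Fract G H))"

definition rat_num :: "'a::field poly fract \<Rightarrow> 'a poly" where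
  "rat_num R = (THE G. coprime G (rat_den R) \<and> R = Fract G (rat_den R))"

definition rat_degree :: "'a::field poly fract \<Rightarrow> nat" where
  "rat_degree R = max (degree (rat_num R)) (degree (rat_den R))"

definition rat_subst :: "'a::field poly \<Rightarrow> 'a poly fract \<Rightarrow> 'a poly fract" where
  "rat_subst P S = poly (map_poly (\<lambda>c. Fract [:c:] 1) P) S"

definition rat_comp :: "'a::field poly fract \<Rightarrow> 'a poly fract \<Rightarrow> 'a poly fract" where
  "rat_comp R S = rat_subst (rat_num R) S / rat_subst (rat_den R) S"

text \<open>
  Iterates are formed in $K(x)$, not pointwise: a point at which some intermediate iterate has a
  pole may well be a regular point of a later iterate.
\<close>

primrec rat_iter :: "'a::field poly fract \<Rightarrow> nat \<Rightarrow> 'a poly fract" where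
  "rat_iter R 0 = Fract [:0, 1:] 1"
| "rat_iter R (Suc n) = rat_comp (rat_iter R n) R"

text \<open>The rational function is defined at \<open>x\<close> (no pole) and has the value \<open>y\<close> there.\<close>

definition rat_has_value ::
    "'a::field poly fract \<Rightarrow> 'a alg_closure \<Rightarrow> 'a alg_closure \<Rightarrow> bool" where
  "rat_has_value R x y \<longleftrightarrow>
     poly (map_poly to_ac (rat_den R)) x \<noteq> 0 \<and>
     poly (map_poly to_ac (rat_num R)) x / poly (map_poly to_ac (rat_den R)) x = y"

definition is_p_reduction :: "'a::field poly fract \<Rightarrow> 'a poly fract \<Rightarrow> bool" where
  "is_p_reduction R R' \<longleftrightarrow>
     (if CHAR('a) = 0 then R' = R
      else (\<exists>k. R = R' ^ (CHAR('a) ^ k)) \<and> \<not> (\<exists>R0. R' = R0 ^ CHAR('a)))"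

definition iter_preimages ::
    "'a::field poly fract \<Rightarrow> nat \<Rightarrow> 'a alg_closure \<Rightarrow> 'a alg_closure set" where
  "iter_preimages R n \<alpha> = {x. rat_has_value (rat_iter R n) x \<alpha>}"

definition Delta :: "'a::field alg_closure \<Rightarrow> 'a poly fract \<Rightarrow> nat \<Rightarrow> nat" where
  "Delta \<alpha> R n = card (iter_preimages R n \<alpha>)"

text \<open>
  Finiteness is stated separately because \<^const>\<open>card\<close> is \<open>0\<close> on infinite sets.
\<close>

definition R_critical :: "'a::field poly fract \<Rightarrow> 'a alg_closure \<Rightarrow> bool" where
  "R_critical R \<alpha> \<longleftrightarrow>
     (\<forall>n. finite (iter_preimages R n \<alpha>)) \<and> bdd_above (range (Delta \<alpha> R))"

definition R_periodic :: "'a::field poly fract \<Rightarrow> 'a alg_closure \<Rightarrow> bool" where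
  "R_periodic R \<alpha> \<longleftrightarrow> (\<exists>N\<ge>1. rat_has_value (rat_iter R N) \<alpha> \<alpha>)"

definition reversed_orbit :: "'a::field poly fract \<Rightarrow> 'a alg_closure \<Rightarrow> 'a alg_closure set" where
  "reversed_orbit R \<alpha> = (\<Union>n. iter_preimages R n \<alpha>)"

definition field_adjoin :: "'a::field alg_closure \<Rightarrow> 'a alg_closure set" where
  "field_adjoin \<alpha> = \<Inter>{F. range to_ac \<subseteq> F \<and> \<alpha> \<in> F \<and>
     (\<forall>x\<in>F. \<forall>y\<in>F. x + y \<in> F \<and> x - y \<in> F \<and> x * y \<in> F \<and> x / y \<in> F)}"

definition ext_degree :: "'a::field alg_closure \<Rightarrow> nat" where
  "ext_degree \<alpha> = vector_space.dim (\<lambda>c x. to_ac c * x) (field_adjoin \<alpha>)"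

end

theory Submission
  imports Defs
begin

text \<open>
  On the projective line over the algebraic closure, $R$ is its $p$-reduction followed by a power
  of Frobenius, which is a bijection. Hence every fibre of $R$, counted with the ramification of
  the separable map $g/h$, has $d$ elements, and the number $N_n$ of points in
  $R^{-n}(\alpha)$ satisfies $N_{n+1} = d N_n - r_{n+1}$, where $r_m$ is the total ramification
  on $R^{-m}(\alpha)$. So $c = 1 - \sum_{m \ge 1} r_m d^{-m}$, and since the $r_m$ are at most
  $2d - 2$ (Riemann-Hurwitz), $N_n = c d^n + O(1)$. The ramification over finite points is
  bounded by the degree of the Wronskian $W$.

  If $\alpha$ is not periodic, the sets $R^{-m}(\alpha)$ are disjoint, so already $\sum r_m$ is at
  most $2d - 2$; if it is periodic of period $N$, the same holds for the ramification $s_m$ on the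
  points reaching $\alpha$ for the first time after $m$ steps, and $r_m = s_m + r_{m-N}$. The
  conjugates of $\alpha$ have the same $r_m$ and for fixed $m$ disjoint preimages, which gains the
  factor $e$.
\<close>

subsection \<open>Backward orbits of ramified maps\<close>

lemma suminf_weight_le:
  fixes s :: "nat \<Rightarrow> real" and d D :: real
  assumes d: "d > 1" and s: "\<And>m. s m \<ge> 0" and D: "\<And>n. (\<Sum>m<n. s m) \<le> D"
  shows "summable (\<lambda>m. s m / d ^ Suc m)"
    and "(\<Sum>m. s m / d ^ Suc m) \<le> D / d"
    and "(\<Sum>m. s m / d ^ Suc m) \<le> s 0 / d + (D - s 0) / d ^ 2"
    and "(\<Sum>m. s m / d ^ Suc m) \<le> s 0 / d + s 1 / d ^ 2 + (D - s 0 - s 1) / d ^ 3"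
proof -
  \<comment> \<open>From index \<open>k\<close> on every weight is at most
    \<open>1 / d ^ Suc k\<close>, so the tail costs at most what is left of the budget
    \<open>D\<close> times that weight. The three bounds are the cases
    \<open>k = 0, 1, 2\<close>.\<close>
  have part: "(\<Sum>m<n. s (m + k) / d ^ Suc (m + k)) \<le> (D - (\<Sum>m<k. s m)) / d ^ Suc k" for k n
  proof -
    have "(\<Sum>m<n. s (m + k) / d ^ Suc (m + k)) \<le> (\<Sum>m<n. s (m + k) / d ^ Suc k)"
      using d s by (intro sum_mono divide_left_mono) (auto intro!: power_increasing mult_left_mono mult_pos_pos)
    also have "\<dots> = (\<Sum>m<n. s (m + k)) / d ^ Suc k"
      by (simp add: sum_divide_distrib)
    also have "(\<Sum>m<n. s (m + k)) = (\<Sum>m<n + k. s m) - (\<Sum>m<k. s m)"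
      by (induction n) auto
    also have "(\<dots>) / d ^ Suc k \<le> (D - (\<Sum>m<k. s m)) / d ^ Suc k"
      using D[of "n + k"] d by (intro divide_right_mono) auto
    finally show ?thesis .
  qed
  have nn: "s m / d ^ Suc m \<ge> 0" for m
    using s d by auto
  show sm: "summable (\<lambda>m. s m / d ^ Suc m)"
  proof (rule summableI_nonneg_bounded[where x = "D / d", OF nn])
    show "(\<Sum>m<n. s m / d ^ Suc m) \<le> D / d" for n
      using part[of 0 n] by simp
  qed
  have tail: "(\<Sum>m. s (m + k) / d ^ Suc (m + k)) \<le> (D - (\<Sum>m<k. s m)) / d ^ Suc k" for k
    using part[of k] by (intro suminf_le_const summable_ignore_initial_segment[OF sm]) auto
  have split: "(\<Sum>m. s m / d ^ Suc m) =
      (\<Sum>m. s (m + k) / d ^ Suc (m + k)) + (\<Sum>m<k. s m / d ^ Suc m)" for k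
    by (rule suminf_split_initial_segment[OF sm])
  show "(\<Sum>m. s m / d ^ Suc m) \<le> D / d"
    using tail[of 0] by simp
  show "(\<Sum>m. s m / d ^ Suc m) \<le> s 0 / d + (D - s 0) / d ^ 2"
    using tail[of 1] split[of 1] by (simp add: power2_eq_square)
  show "(\<Sum>m. s m / d ^ Suc m) \<le> s 0 / d + s 1 / d ^ 2 + (D - s 0 - s 1) / d ^ 3"
    using tail[of 2] split[of 2] by (simp add: eval_nat_numeral algebra_simps)
qed

lemma geometric_weight:
  fixes d :: real
  assumes "d > 1"
  shows "(\<lambda>m. a / d ^ Suc m) sums (a / (d - 1))"
proof -
  have "(\<lambda>m. (a / d) * (1 / d) ^ m) sums ((a / d) * (1 / (1 - 1 / d)))"
    using assms by (intro sums_mult geometric_sums) auto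
  also have "(a / d) * (1 / (1 - 1 / d)) = a / (d - 1)"
    using assms by (simp add: field_simps)
  finally show ?thesis
    by (simp add: power_divide mult.commute)
qed

text \<open>\<open>\<rho>\<close> stands for multiplicity minus one and enters only through its
  sums: over a fibre it accounts for the missing points, over any finite set it obeys
  Riemann-Hurwitz. So \<open>S\<close> may be inseparable while \<open>\<rho>\<close> is taken from
  its separable part.\<close>

locale ramified_map =
  fixes S :: "'b \<Rightarrow> 'b" and \<rho> :: "'b \<Rightarrow> nat" and d :: nat
  assumes d_ge_2: "d \<ge> 2"
    and finite_fibre: "finite (S -` {t})"
    and card_fibre: "card (S -` {t}) + sum \<rho> (S -` {t}) = d"
    and fibre_nonempty: "S -` {t} \<noteq> {}"
    and hurwitz: "finite Y \<Longrightarrow> sum \<rho> Y \<le> 2 * d - 2"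
begin

definition pre :: "nat \<Rightarrow> 'b \<Rightarrow> 'b set" where
  "pre n t = {x. (S ^^ n) x = t}"

definition ram :: "nat \<Rightarrow> 'b \<Rightarrow> nat" where
  "ram n t = sum \<rho> (pre n t)"

text \<open>The limit of \<open>card (pre n t) / d ^ n\<close>, obtained by solving the recursion
  \<open>card_pre_Suc\<close>.\<close>

definition growth :: "'b \<Rightarrow> real" where
  "growth t = 1 - (\<Sum>m. real (ram (Suc m) t) / real d ^ Suc m)"

lemma pre_0 [simp]: "pre 0 t = {t}"
  by (auto simp: pre_def)

lemma pre_Suc: "pre (Suc n) t = (\<Union>u\<in>pre n t. S -` {u})"
  by (auto simp: pre_def funpow_swap1)

lemma pre_1: "pre (Suc 0) t = S -` {t}"
  by (simp add: pre_Suc)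

lemma finite_pre [simp]: "finite (pre n t)"
  by (induction n) (auto simp: pre_Suc intro: finite_fibre)

lemma pre_nonempty: "pre n t \<noteq> {}"
  using fibre_nonempty by (induction n) (auto simp: pre_Suc)

lemma card_pre_pos: "card (pre n t) > 0"
  using pre_nonempty by (simp add: card_gt_0_iff)

lemma pre_disjoint: "t \<noteq> u \<Longrightarrow> pre n t \<inter> pre n u = {}"
  by (auto simp: pre_def)

lemma card_pre_Suc: "card (pre (Suc n) t) + ram (Suc n) t = d * card (pre n t)"
proof -
  have "card (pre (Suc n) t) = (\<Sum>u\<in>pre n t. card (S -` {u}))"
    unfolding pre_Suc by (subst card_UN_disjoint) (auto intro: finite_fibre)
  moreover have "ram (Suc n) t = (\<Sum>u\<in>pre n t. sum \<rho> (S -` {u}))"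
    unfolding ram_def pre_Suc by (subst sum.UNION_disjoint) (auto intro: finite_fibre)
  ultimately show ?thesis
    using card_fibre by (simp flip: sum.distrib)
qed

lemma card_pre_1: "card (pre (Suc 0) t) + ram (Suc 0) t = d"
  using card_pre_Suc[of 0 t] by simp

lemma ram_1_le: "ram (Suc 0) t \<le> d - 1"
  using card_pre_1[of t] card_pre_pos[of "Suc 0" t] by simp

lemma ram_le: "ram n t \<le> 2 * d - 2"
  unfolding ram_def by (rule hurwitz) simp

lemma real_ram_le: "real (ram n t) \<le> 2 * real d - 2"
  using ram_le[of n t] d_ge_2 by linarith

lemma summable_ram: "summable (\<lambda>m. real (ram (Suc m) t) / real d ^ Suc m)"
proof (rule summable_comparison_test')
  show "summable (\<lambda>m. (2 * real d - 2) / real d ^ Suc m)"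
    using geometric_weight[of "real d"] d_ge_2 by (auto intro: sums_summable)
  show "norm (real (ram (Suc m) t) / real d ^ Suc m) \<le> (2 * real d - 2) / real d ^ Suc m" for m
    using real_ram_le[of "Suc m" t] d_ge_2 by (auto intro: divide_right_mono)
qed

lemma card_pre_eq:
  "real (card (pre n t)) = real d ^ n * (1 - (\<Sum>m<n. real (ram (Suc m) t) / real d ^ Suc m))"
proof (induction n)
  case (Suc n)
  have "real (card (pre (Suc n) t)) = real d * real (card (pre n t)) - real (ram (Suc n) t)"
    using card_pre_Suc[of n t] by (metis add_diff_cancel_right' of_nat_add of_nat_mult)
  also have "\<dots> = real d ^ Suc n * (1 - (\<Sum>m<Suc n. real (ram (Suc m) t) / real d ^ Suc m))"
    unfolding Suc using d_ge_2 by (simp add: field_simps)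
  finally show ?case .
qed simp

lemma growth_le_1: "growth t \<le> 1"
  unfolding growth_def using summable_ram[of t] by (simp add: suminf_nonneg)

text \<open>The error is \<open>d ^ n\<close> times the tail of the series from index
  \<open>n\<close> on. Each \<open>ram\<close> is at most \<open>2 * (d - 1)\<close>, so a geometric
  series bounds the tail by \<open>2 / d ^ n\<close>.\<close>

lemma card_pre_asymp: "\<bar>real (card (pre n t)) - growth t * real d ^ n\<bar> \<le> 2"
proof -
  define a where "a m = real (ram (Suc m) t) / real d ^ Suc m" for m
  have sm: "summable a"
    unfolding a_def by (rule summable_ram)
  have "growth t = 1 - (\<Sum>m. a (m + n)) - (\<Sum>m<n. a m)"
    using suminf_split_initial_segment[OF sm, of n] unfolding growth_def a_def[symmetric] by simp
  moreover have "real (card (pre n t)) = real d ^ n * (1 - (\<Sum>m<n. a m))"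
    unfolding a_def by (rule card_pre_eq)
  ultimately have eq: "real (card (pre n t)) - growth t * real d ^ n = real d ^ n * (\<Sum>m. a (m + n))"
    by (simp only:) (simp add: algebra_simps)
  have g: "(\<lambda>m. ((2 * real d - 2) / real d ^ n) / real d ^ Suc m) sums
      ((2 * real d - 2) / real d ^ n / (real d - 1))"
    using d_ge_2 by (intro geometric_weight) simp
  have "(\<Sum>m. a (m + n)) \<le> (2 * real d - 2) / real d ^ n / (real d - 1)"
    unfolding sums_unique[OF g]
  proof (rule suminf_le[OF _ summable_ignore_initial_segment[OF sm] sums_summable[OF g]])
    show "a (m + n) \<le> ((2 * real d - 2) / real d ^ n) / real d ^ Suc m" for m
    proof -
      have "a (m + n) \<le> (2 * real d - 2) / real d ^ Suc (m + n)"
        unfolding a_def using real_ram_le by (intro divide_right_mono) auto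
      thus ?thesis
        by (simp add: power_add mult_ac)
    qed
  qed
  also have "\<dots> = 2 / real d ^ n"
    using d_ge_2 by (simp add: field_simps)
  finally have "real d ^ n * (\<Sum>m. a (m + n)) \<le> 2"
    using d_ge_2 by (simp add: field_simps)
  moreover have "(\<Sum>m. a (m + n)) \<ge> 0"
    by (intro suminf_nonneg summable_ignore_initial_segment[OF sm]) (auto simp: a_def)
  ultimately show ?thesis
    unfolding eq by simp
qed

section \<open>Periodic points and first arrivals\<close>

definition periodic :: "'b \<Rightarrow> bool" where
  "periodic t \<longleftrightarrow> (\<exists>n\<ge>1. (S ^^ n) t = t)"

lemma pre_overlap:
  assumes "x \<in> pre m t" "x \<in> pre n u" "m \<le> n"
  shows "(S ^^ (n - m)) t = u"
proof -
  have "(S ^^ (n - m)) ((S ^^ m) x) = (S ^^ n) x"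
    using assms(3) by (metis comp_apply funpow_add le_add_diff_inverse2)
  thus ?thesis
    using assms by (simp add: pre_def)
qed

text \<open>Charging all of \<open>D\<close> at the largest weight gives the first bound. For the
  second, the cost increases with the ramification on the first level, which is at most
  \<open>min (d - 1) D\<close>; the rest is charged at \<open>1 / d ^ 2\<close>.\<close>

lemma growth_ge_of_bounded_sum:
  assumes "\<And>n. (\<Sum>m<n. real (ram (Suc m) t)) \<le> D"
  shows "growth t \<ge> 1 - D / real d"
    and "growth t \<ge> 1 - min (real d - 1) D / real d - (D - min (real d - 1) D) / real d ^ 2"
proof -
  let ?r = "\<lambda>m. real (ram (Suc m) t)"
  have d1: "real d > 1"
    using d_ge_2 by simp
  note w = suminf_weight_le[of "real d" ?r D, OF d1 _ assms]
  show "growth t \<ge> 1 - D / real d"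
    using w(2) by (simp add: growth_def)
  define M where "M = min (real d - 1) D"
  have "?r 0 \<le> M"
    using assms[of 1] ram_1_le[of t] d1 unfolding M_def by auto
  hence "?r 0 * (real d - 1) \<le> M * (real d - 1)"
    using d1 by (intro mult_right_mono) auto
  hence "?r 0 / real d + (D - ?r 0) / real d ^ 2 \<le> M / real d + (D - M) / real d ^ 2"
    using d1 by (simp add: field_simps power2_eq_square)
  thus "growth t \<ge> 1 - M / real d - (D - M) / real d ^ 2"
    using w(3) by (simp add: growth_def)
qed

lemma growth_ge_of_bounded:
  assumes "\<And>m. real (ram (Suc m) t) \<le> D"
  shows "growth t \<ge> 1 - D / (real d - 1)"
proof -
  have g: "(\<lambda>m. D / real d ^ Suc m) sums (D / (real d - 1))"
    using d_ge_2 by (intro geometric_weight) simp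
  have "(\<Sum>m. real (ram (Suc m) t) / real d ^ Suc m) \<le> (\<Sum>m. D / real d ^ Suc m)"
    by (intro suminf_le summable_ram sums_summable[OF g] divide_right_mono assms) auto
  thus ?thesis
    using sums_unique[OF g] by (simp add: growth_def)
qed

text \<open>The removed levels start at 1 and not at 0: a periodic \<open>t\<close> reaches itself
  after 0 steps, yet it has to be counted on the level of its period.\<close>

definition first_pre :: "nat \<Rightarrow> 'b \<Rightarrow> 'b set" where
  "first_pre m t = pre m t - (\<Union>j\<in>{1..<m}. pre j t)"

lemma finite_first_pre: "finite (first_pre m t)"
  by (simp add: first_pre_def)

text \<open>First arrivals on different levels are disjoint, so the sum is the ramification of a
  single finite set. The premise speaks of the strict backward orbit only, so that a bound valid
  away from infinity can be supplied.\<close>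

lemma sum_first_pre_le:
  assumes "\<And>Y. finite Y \<Longrightarrow> Y \<subseteq> (\<Union>m\<in>{1..}. pre m t) \<Longrightarrow> sum \<rho> Y \<le> D"
  shows "(\<Sum>m<n. sum \<rho> (first_pre (Suc m) t)) \<le> D"
proof -
  have disj: "first_pre (Suc i) t \<inter> first_pre (Suc j) t = {}" if "i < j" for i j
    using that by (auto simp: first_pre_def)
  have "(\<Sum>m<n. sum \<rho> (first_pre (Suc m) t)) = sum \<rho> (\<Union>m\<in>{..<n}. first_pre (Suc m) t)"
  proof (subst sum.UNION_disjoint)
    show "\<forall>i\<in>{..<n}. \<forall>j\<in>{..<n}. i \<noteq> j \<longrightarrow> first_pre (Suc i) t \<inter> first_pre (Suc j) t = {}"
      using disj by (metis inf_commute linorder_neqE_nat)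
  qed (auto simp: first_pre_def)
  also have "\<dots> \<le> D"
    by (rule assms) (auto simp: first_pre_def)
  finally show ?thesis .
qed

text \<open>A point on two levels would make \<open>t\<close> return to itself after the difference
  of the levels.\<close>

lemma first_pre_nonperiodic:
  assumes "\<not> periodic t"
  shows "first_pre m t = pre m t"
proof -
  have "x \<notin> pre j t" if "x \<in> pre m t" "j < m" for x j
    using pre_overlap[of x j t m t] that assms
    by (auto simp: periodic_def dest: spec[of _ "m - j"])
  thus ?thesis
    by (auto simp: first_pre_def)
qed

lemma sum_ram_nonperiodic_le:
  assumes "\<not> periodic t" and "\<And>Y. finite Y \<Longrightarrow> Y \<subseteq> (\<Union>m\<in>{1..}. pre m t) \<Longrightarrow> sum \<rho> Y \<le> D"
  shows "(\<Sum>m<n. real (ram (Suc m) t)) \<le> real D"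
proof -
  have "(\<Sum>m<n. ram (Suc m) t) \<le> D"
    using sum_first_pre_le[of t D n, OF assms(2)]
    by (simp add: first_pre_nonperiodic[OF assms(1)] ram_def)
  thus ?thesis
    by (metis of_nat_le_iff of_nat_sum)
qed

lemma growth_nonperiodic_ge:
  assumes "\<not> periodic t"
  shows "growth t \<ge> 1 / real d ^ 2"
proof -
  have "(\<Sum>m<n. real (ram (Suc m) t)) \<le> 2 * real d - 2" for n
    using sum_ram_nonperiodic_le[OF assms hurwitz, of n] d_ge_2 by (simp add: of_nat_diff)
  from growth_ge_of_bounded_sum(2)[OF this] have
    "growth t \<ge> 1 - (real d - 1) / real d - (2 * real d - 2 - (real d - 1)) / real d ^ 2"
    using d_ge_2 by (simp add: min_def)
  also have "1 - (real d - 1) / real d - (2 * real d - 2 - (real d - 1)) / real d ^ 2 = 1 / real d ^ 2"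
    using d_ge_2 by (simp add: field_simps power2_eq_square)
  finally show ?thesis .
qed

lemma funpow_period: "(S ^^ N) t = t \<Longrightarrow> (S ^^ (j + k * N)) t = (S ^^ j) t"
  by (induction k) (auto simp: funpow_add add.assoc[symmetric] add.commute[of N])

text \<open>When a point reaches \<open>t\<close> after \<open>j\<close> steps and again after
  \<open>m + 1\<close> steps, the difference is a return time of \<open>t\<close>, hence a multiple
  of the least period \<open>N\<close>. So the point is also at \<open>t\<close> after
  \<open>m + 1 - N\<close> steps.\<close>

lemma pre_period:
  assumes "(S ^^ N) t = t" and N: "N \<ge> 1" and least: "\<And>j. 1 \<le> j \<Longrightarrow> j < N \<Longrightarrow> (S ^^ j) t \<noteq> t"
  shows "pre (Suc m) t = first_pre (Suc m) t \<union> (if m < N then {} else pre (Suc (m - N)) t)"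
    and "m \<ge> N \<Longrightarrow> first_pre (Suc m) t \<inter> pre (Suc (m - N)) t = {}"
proof -
  show "m \<ge> N \<Longrightarrow> first_pre (Suc m) t \<inter> pre (Suc (m - N)) t = {}"
    using N by (auto simp: first_pre_def)
  have shift: "x \<in> pre (j + k * N) t" if "x \<in> pre j t" for x j k
  proof -
    have "(S ^^ (k * N + j)) x = (S ^^ (0 + k * N)) ((S ^^ j) x)"
      by (simp add: funpow_add)
    thus ?thesis
      using that funpow_period[OF assms(1), of 0 k] by (simp add: pre_def add.commute)
  qed
  have "m \<ge> N \<and> x \<in> pre (Suc (m - N)) t"
    if x: "x \<in> pre (Suc m) t" "x \<notin> first_pre (Suc m) t" for x
  proof -
    from x obtain j where j: "j \<ge> 1" "j < Suc m" "x \<in> pre j t"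
      by (auto simp: first_pre_def)
    define l where "l = Suc m - j"
    have l: "l \<ge> 1" "(S ^^ l) t = t"
      using pre_overlap[OF j(3) x(1)] j by (auto simp: l_def)
    have "(S ^^ (l mod N + (l div N) * N)) t = (S ^^ (l mod N)) t"
      by (rule funpow_period[OF assms(1)])
    hence "(S ^^ (l mod N)) t = t"
      using l by (simp add: mult.commute)
    hence "l mod N = 0"
      using least[of "l mod N"] N mod_less_divisor[of N l] by (cases "l mod N = 0") auto
    then obtain k where k: "l = Suc k * N"
      using l(1) by (metis mod_0_imp_dvd dvdE mult.commute not0_implies_Suc mult_0 not_one_le_zero)
    have "m \<ge> N"
      using k j(1) unfolding l_def by (cases "m \<ge> N") auto
    moreover have "Suc (m - N) = j + k * N"
      using k j \<open>m \<ge> N\<close> unfolding l_def by auto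
    ultimately show ?thesis
      using shift[OF j(3), of k] by simp
  qed
  moreover have "x \<in> pre (Suc m) t" if "m \<ge> N" "x \<in> pre (Suc (m - N)) t" for x
    using shift[OF that(2), of 1] that(1) by (simp add: Suc_diff_le)
  moreover have "first_pre (Suc m) t \<subseteq> pre (Suc m) t"
    by (auto simp: first_pre_def)
  ultimately show "pre (Suc m) t = first_pre (Suc m) t \<union> (if m < N then {} else pre (Suc (m - N)) t)"
    by (cases "m < N") (simp_all, blast+)
qed

text \<open>This is the relation between the generating functions at \<open>1 / d\<close> that
  follows from \<open>ram (Suc m) t\<close> being the ramification of the first arrivals plus
  \<open>ram (Suc (m - N)) t\<close>; shifting by \<open>N\<close> multiplies a series by
  \<open>1 / d ^ N\<close>.\<close>

lemma growth_period:
  assumes N: "(S ^^ N) t = t" "N \<ge> 1" "\<And>j. 1 \<le> j \<Longrightarrow> j < N \<Longrightarrow> (S ^^ j) t \<noteq> t"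
  shows "(1 - 1 / real d ^ N) * (1 - growth t) =
    (\<Sum>m. real (sum \<rho> (first_pre (Suc m) t)) / real d ^ Suc m)"
proof -
  define a where "a m = real (ram (Suc m) t) / real d ^ Suc m" for m
  define b where "b m = (if m < N then 0 else a (m - N) / real d ^ N)" for m
  have a: "a sums (1 - growth t)"
    unfolding a_def growth_def using summable_ram by (simp add: summable_sums del: power_Suc)
  hence "(\<lambda>m. a m / real d ^ N) sums ((1 - growth t) / real d ^ N)"
    by (rule sums_divide)
  hence "(\<lambda>m. b (m + N)) sums ((1 - growth t) / real d ^ N)"
    by (simp add: b_def)
  hence "b sums ((1 - growth t) / real d ^ N + (\<Sum>m<N. b m))"
    by (rule sums_iff_shift[THEN iffD1])
  hence b: "b sums ((1 - growth t) / real d ^ N)"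
    by (simp add: b_def)
  have "real (sum \<rho> (first_pre (Suc m) t)) / real d ^ Suc m = a m - b m" for m
  proof (cases "m < N")
    case True
    thus ?thesis
      using pre_period(1)[OF N, of m] by (simp add: a_def b_def ram_def)
  next
    case False
    have "ram (Suc m) t = sum \<rho> (first_pre (Suc m) t) + ram (Suc (m - N)) t"
    proof -
      have "pre (Suc m) t = first_pre (Suc m) t \<union> pre (Suc (m - N)) t"
        using pre_period(1)[OF N, of m] False by simp
      hence "ram (Suc m) t = sum \<rho> (first_pre (Suc m) t \<union> pre (Suc (m - N)) t)"
        by (simp add: ram_def)
      also have "\<dots> = sum \<rho> (first_pre (Suc m) t) + ram (Suc (m - N)) t"
        unfolding ram_def using pre_period(2)[OF N, of m] False
        by (intro sum.union_disjoint) (auto simp: finite_first_pre)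
      finally show ?thesis .
    qed
    moreover have "real d ^ Suc m = real d ^ Suc (m - N) * real d ^ N"
      using False by (simp flip: power_add)
    ultimately show ?thesis
      using False by (simp add: a_def b_def add_divide_distrib)
  qed
  hence "(\<Sum>m. real (sum \<rho> (first_pre (Suc m) t)) / real d ^ Suc m) =
      1 - growth t - (1 - growth t) / real d ^ N"
    using sums_unique[OF sums_diff[OF a b]] by (simp only:)
  thus ?thesis
    by (simp add: algebra_simps add_divide_distrib diff_divide_distrib)
qed

lemma growth_periodic_ge:
  assumes per: "periodic t" and unb: "\<And>M. \<exists>n. card (pre n t) > M"
  shows "growth t \<ge> 1 / real d ^ 2 - 1 / real d ^ 3"
proof -
  define N where "N = (LEAST n. n \<ge> 1 \<and> (S ^^ n) t = t)"
  have "N \<ge> 1 \<and> (S ^^ N) t = t"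
    using LeastI_ex[of "\<lambda>n. n \<ge> 1 \<and> (S ^^ n) t = t"] per
    unfolding N_def periodic_def by blast
  moreover have "(S ^^ j) t \<noteq> t" if "1 \<le> j" "j < N" for j
    using not_less_Least[of j "\<lambda>n. n \<ge> 1 \<and> (S ^^ n) t = t"] that unfolding N_def by blast
  ultimately have N: "(S ^^ N) t = t" "N \<ge> 1" "\<And>j. 1 \<le> j \<Longrightarrow> j < N \<Longrightarrow> (S ^^ j) t \<noteq> t"
    by blast+
  define s where "s m = real (sum \<rho> (first_pre (Suc m) t))" for m
  define T where "T = (\<Sum>m. s m / real d ^ Suc m)"
  define u where "u = 1 / real d"
  have u: "u > 0" "u \<le> 1 / 2" "real d * u = 1"
    using d_ge_2 by (auto simp: u_def field_simps)
  have div: "x / real d ^ k = x * u ^ k" for x k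
    by (simp add: u_def power_one_over)
  \<comment> \<open>\<open>\<kappa>\<close> is 1 minus the claimed bound. Since
    \<open>(1 - u ^ N) * (1 - growth t) = T\<close>, the goal becomes
    \<open>T \<le> (1 - u ^ N) * \<kappa>\<close>.\<close>
  define \<kappa> where "\<kappa> = 1 - u ^ 2 + u ^ 3"
  have d1: "real d > 1"
    using d_ge_2 by simp
  have s_nn: "s m \<ge> 0" for m
    by (simp add: s_def del: of_nat_sum)
  have "(\<Sum>m<n. s m) \<le> 2 * real d - 2" for n
  proof -
    have "(\<Sum>m<n. sum \<rho> (first_pre (Suc m) t)) \<le> 2 * d - 2"
      by (rule sum_first_pre_le) (rule hurwitz)
    hence "(\<Sum>m<n. s m) \<le> real (2 * d - 2)"
      unfolding s_def by (metis of_nat_le_iff of_nat_sum)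
    thus ?thesis
      using d_ge_2 by (simp add: of_nat_diff)
  qed
  note w = suminf_weight_le(3,4)[of "real d" s, OF d1 s_nn this, folded T_def]
  have s0: "s 0 = real d - real (card (pre (Suc 0) t))"
  proof -
    have "card (pre (Suc 0) t) + sum \<rho> (first_pre (Suc 0) t) = d"
      using card_pre_1[of t] by (simp add: first_pre_def ram_def)
    thus ?thesis
      unfolding s_def by linarith
  qed
  have T2: "T \<le> s 0 * u + (2 * real d - 2 - s 0) * u ^ 2"
    using w(1) div[of _ 1] by (simp add: div)
  have T3: "T \<le> s 0 * u + s 1 * u ^ 2 + (2 * real d - 2 - s 0 - s 1) * u ^ 3"
    using w(2) div[of _ 1] by (simp add: div)
  \<comment> \<open>The estimate increases with \<open>s 0\<close>, which is \<open>d\<close> minus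
    the size of the fibre, so any lower bound \<open>k\<close> for that size may be inserted;
    \<open>d * u = 1\<close> then eliminates \<open>d\<close>.\<close>
  have T2': "T \<le> 1 - (k - 1) * u + (k - 2) * u ^ 2" if "real (card (pre (Suc 0) t)) \<ge> k" for k
  proof -
    have "s 0 * (u - u ^ 2) \<le> (real d - k) * (u - u ^ 2)"
      using that u s0 by (intro mult_right_mono) (auto simp: power2_eq_square)
    hence "T \<le> (real d - k) * (u - u ^ 2) + (2 * real d - 2) * u ^ 2"
      using T2 by (simp add: algebra_simps)
    also have "\<dots> = (real d * u) * (1 + u) - k * (u - u ^ 2) - 2 * u ^ 2"
      by (simp add: algebra_simps power2_eq_square)
    finally show ?thesis
      unfolding u(3) by (simp add: algebra_simps)
  qed
  have T3': "T \<le> s 0 * u + real d * u ^ 2 - u ^ 2 + (real d - 1 - s 0) * u ^ 3" if "s 1 \<le> real d - 1"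
  proof -
    have "s 1 * (u ^ 2 - u ^ 3) \<le> (real d - 1) * (u ^ 2 - u ^ 3)"
      using that u by (intro mult_right_mono) (auto simp: power2_eq_square power3_eq_cube)
    thus ?thesis
      using T3 by (simp add: algebra_simps)
  qed
  have "T \<le> (1 - u ^ N) * \<kappa>"
  proof -
    consider "N = 1" | "N = 2" | "N \<ge> 3"
      using N(2) by linarith
    thus ?thesis
    proof cases
      case 1
      hence "t \<in> pre (Suc 0) t"
        using N(1) by (simp add: pre_def)
      \<comment> \<open>A totally ramified fixed point would be its own whole backward orbit, which
        the unbounded preimage counts exclude.\<close>
      have "\<not> pre (Suc 0) t \<subseteq> {t}"
      proof
        assume *: "pre (Suc 0) t \<subseteq> {t}"
        have "pre n t \<subseteq> {t}" for n
          using * by (induction n) (auto simp: pre_Suc)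
        hence "card (pre n t) \<le> 1" for n
          using card_mono[of "{t}" "pre n t"] by simp
        with unb[of 1] show False
          by (meson not_less)
      qed
      then obtain w where w: "w \<in> pre (Suc 0) t" "w \<noteq> t"
        by auto
      have sub: "{t, w} \<subseteq> pre (Suc 0) t"
        using w \<open>t \<in> _\<close> by simp
      hence "card {t, w} \<le> card (pre (Suc 0) t)"
        by (intro card_mono) auto
      hence "card (pre (Suc 0) t) \<ge> 2"
        using w by simp
      then consider "card (pre (Suc 0) t) = 2" | "card (pre (Suc 0) t) \<ge> 3"
        by linarith
      thus ?thesis
      proof cases
        case 2
        have "T \<le> 1 - 2 * u + u ^ 2"
          using T2'[of 3] 2 by simp
        moreover have "(1 - u) * \<kappa> - (1 - 2 * u + u ^ 2) = u * (1 - u) ^ 2 + u ^ 3 * (1 - u)"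
          by (simp add: \<kappa>_def algebra_simps eval_nat_numeral)
        moreover have "u * (1 - u) ^ 2 + u ^ 3 * (1 - u) \<ge> 0"
          using u by (intro add_nonneg_nonneg mult_nonneg_nonneg) auto
        ultimately show ?thesis
          using \<open>N = 1\<close> by simp
      next
        case 1
        hence "{t, w} = pre (Suc 0) t"
          using sub w by (intro card_subset_eq) auto
        \<comment> \<open>A point of the second level lies over \<open>t\<close> or over
          \<open>w\<close>, and those over \<open>t\<close> are already in the first level. The new
          ramification thus sits in one fibre, where it is at most \<open>d - 1\<close>.\<close>
        hence "first_pre (Suc 1) t \<subseteq> pre (Suc 0) w"
          by (auto simp: first_pre_def pre_Suc)
        hence "sum \<rho> (first_pre (Suc 1) t) \<le> ram (Suc 0) w"
          unfolding ram_def by (intro sum_mono2) auto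
        hence "sum \<rho> (first_pre (Suc 1) t) \<le> d - 1"
          using ram_1_le[of w] by linarith
        hence "s 1 \<le> real d - 1"
          using d_ge_2 unfolding s_def by linarith
        from T3'[OF this] s0 1
        have "T \<le> (real d - 2) * u + real d * u ^ 2 - u ^ 2 + u ^ 3"
          by simp
        also have "\<dots> = (real d * u) * (1 + u) - 2 * u - u ^ 2 + u ^ 3"
          by (simp add: algebra_simps eval_nat_numeral)
        finally have "T \<le> 1 - u - u ^ 2 + u ^ 3"
          unfolding u(3) by simp
        moreover have "(1 - u) * \<kappa> - (1 - u - u ^ 2 + u ^ 3) = u ^ 3 * (1 - u)"
          by (simp add: \<kappa>_def algebra_simps eval_nat_numeral)
        moreover have "u ^ 3 * (1 - u) \<ge> 0"
          using u by (intro mult_nonneg_nonneg) auto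
        ultimately show ?thesis
          using \<open>N = 1\<close> by simp
      qed
    next
      case 2
      show ?thesis
      proof (cases "card (pre (Suc 0) t) \<ge> 2")
        case True
        have "T \<le> 1 - u"
          using T2'[of 2] True by simp
        moreover have "(1 - u ^ 2) * \<kappa> - (1 - u) = u * (1 - u) ^ 2 + u ^ 4 * (1 - u)"
          by (simp add: \<kappa>_def algebra_simps eval_nat_numeral)
        moreover have "u * (1 - u) ^ 2 + u ^ 4 * (1 - u) \<ge> 0"
          using u by (intro add_nonneg_nonneg mult_nonneg_nonneg) auto
        ultimately show ?thesis
          using 2 by simp
      next
        case False
        hence card1: "card (pre (Suc 0) t) = 1"
          using card_pre_pos[of "Suc 0" t] by linarith
        then obtain v where v: "pre (Suc 0) t = {v}"
          by (auto simp: card_1_singleton_iff)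
        hence pre2: "pre (Suc 1) t = pre (Suc 0) v"
          by (simp add: pre_Suc)
        have tv: "t \<in> pre (Suc 0) v"
          using N(1) 2 unfolding pre2[symmetric] by (simp add: pre_def numeral_2_eq_2)
        \<comment> \<open>Otherwise \<open>{t, v}\<close> would be a totally ramified 2-cycle
          containing every preimage. With a second point over \<open>v\<close>, the ramification
          there is at most \<open>d - 2\<close> and not just \<open>d - 1\<close>.\<close>
        have "\<not> pre (Suc 0) v \<subseteq> {t}"
        proof
          assume *: "pre (Suc 0) v \<subseteq> {t}"
          have "pre n t \<subseteq> {t, v}" for n
          proof (induction n)
            case (Suc n)
            hence "pre (Suc n) t \<subseteq> S -` {t} \<union> S -` {v}"
              unfolding pre_Suc by auto
            thus ?case
              using * v by (auto simp: pre_1)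
          qed simp
          hence "card (pre n t) \<le> card {t, v}" for n
            by (intro card_mono) auto
          with unb[of "card {t, v}"] show False
            by (meson not_less)
        qed
        then obtain w where w: "w \<in> pre (Suc 0) v" "w \<noteq> t"
          by auto
        hence "card {t, w} \<le> card (pre (Suc 0) v)"
          using tv by (intro card_mono) auto
        hence "ram (Suc 0) v + 2 \<le> d"
          using w(2) card_pre_1[of v] by simp
        moreover have "sum \<rho> (first_pre (Suc 1) t) \<le> ram (Suc 0) v"
          unfolding ram_def pre2[symmetric] by (intro sum_mono2) (auto simp: first_pre_def)
        ultimately have s1: "s 1 \<le> real d - 2"
          unfolding s_def by linarith
        have "s 1 * (u ^ 2 - u ^ 3) \<le> (real d - 2) * (u ^ 2 - u ^ 3)"
          using s1 u by (intro mult_right_mono) (auto simp: power2_eq_square power3_eq_cube)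
        with T3 s0 card1 have "T \<le> (real d - 1) * u + (real d - 2) * u ^ 2 + u ^ 3"
          by (simp add: algebra_simps)
        also have "\<dots> = (real d * u) * (1 + u) - u - 2 * u ^ 2 + u ^ 3"
          by (simp add: algebra_simps eval_nat_numeral)
        finally have "T \<le> 1 - 2 * u ^ 2 + u ^ 3"
          unfolding u(3) by simp
        moreover have "(1 - u ^ 2) * \<kappa> - (1 - 2 * u ^ 2 + u ^ 3) = u ^ 4 * (1 - u)"
          by (simp add: \<kappa>_def algebra_simps eval_nat_numeral)
        moreover have "u ^ 4 * (1 - u) \<ge> 0"
          using u by (intro mult_nonneg_nonneg) auto
        ultimately show ?thesis
          using 2 by simp
      qed
    next
      case 3
      \<comment> \<open>Total ramification over \<open>t\<close> is now permitted. The term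
        \<open>u ^ 3\<close> in \<open>\<kappa>\<close> originates here: \<open>1 - u ^ 2\<close>
        alone exceeds \<open>(1 - u ^ 3) * (1 - u ^ 2)\<close>. Period 3 is the worst, because
        \<open>1 - u ^ N\<close> grows with \<open>N\<close>.\<close>
      have "T \<le> 1 - u ^ 2"
        using T2'[of 1] card_pre_pos[of "Suc 0" t] by simp
      also have "1 - u ^ 2 \<le> (1 - u ^ 3) * \<kappa>"
      proof -
        have "(1 - u ^ 3) * \<kappa> - (1 - u ^ 2) = u ^ 5 * (1 - u)"
          by (simp add: \<kappa>_def algebra_simps eval_nat_numeral)
        moreover have "u ^ 5 * (1 - u) \<ge> 0"
          using u by (intro mult_nonneg_nonneg) auto
        ultimately show ?thesis
          by linarith
      qed
      also have "\<dots> \<le> (1 - u ^ N) * \<kappa>"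
      proof (rule mult_right_mono)
        show "1 - u ^ 3 \<le> 1 - u ^ N"
          using 3 u by (simp add: power_decreasing)
        have "u ^ 2 \<le> 1"
          using u by (intro power_le_one) auto
        thus "\<kappa> \<ge> 0"
          using u by (simp add: \<kappa>_def)
      qed
      finally show ?thesis .
    qed
  qed
  moreover have "(1 - u ^ N) * (1 - growth t) = T"
    using growth_period[OF N] div[of 1 N] unfolding T_def s_def by simp
  moreover have "1 - u ^ N > 0"
    using u N(2) by (simp add: power_less_one_iff)
  ultimately have "1 - growth t \<le> \<kappa>"
    using mult_le_cancel_left_pos[of "1 - u ^ N" "1 - growth t" \<kappa>] by simp
  thus ?thesis
    unfolding \<kappa>_def div by simp
qed

lemma growth_ge:
  assumes "\<And>M. \<exists>n. card (pre n t) > M"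
  shows "growth t \<ge> 1 / real d ^ 2 - 1 / real d ^ 3"
proof (cases "periodic t")
  case False
  have "1 / real d ^ 3 \<ge> 0"
    by simp
  with growth_nonperiodic_ge[OF False] show ?thesis
    by linarith
next
  case True
  show ?thesis
    by (rule growth_periodic_ge[OF True assms])
qed

end

subsection \<open>Ramification of rational maps on the projective line\<close>

lemma sum_order_eq_degree:
  fixes p :: "'b::alg_closed_field poly"
  assumes "p \<noteq> 0"
  shows "(\<Sum>x | poly p x = 0. order x p) = degree p"
  using assms
proof (induction "degree p" arbitrary: p)
  case 0
  hence "{x. poly p x = 0} = {}"
    by (metis (mono_tags, lifting) degree_eq_zeroE empty_Collect_eq mult_zero_right pCons_0_0 poly_0 poly_pCons add.right_neutral)
  thus ?case
    using 0 by simp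
next
  case (Suc n)
  then obtain a where a: "poly p a = 0"
    using alg_closed_imp_poly_has_root[of p] by auto
  then obtain q where q: "p = [:-a, 1:] * q"
    by (auto simp: poly_eq_0_iff_dvd elim: dvdE)
  have "q \<noteq> 0"
    using Suc q by auto
  have deg: "degree p = Suc (degree q)"
    unfolding q using \<open>q \<noteq> 0\<close> by (subst degree_mult_eq) auto
  have IH: "(\<Sum>x | poly q x = 0. order x q) = degree q"
    using Suc \<open>q \<noteq> 0\<close> deg by simp
  have ord: "order x p = (if x = a then 1 else 0) + order x q" for x
  proof -
    have "order x p = order x [:-a, 1:] + order x q"
      unfolding q by (rule order_mult) (use Suc q in auto)
    moreover have "order x [:-a, 1:] = (if x = a then 1 else 0)"
      using order_power_n_n[of a 1] by (auto intro!: order_0I)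
    ultimately show ?thesis
      by simp
  qed
  have fin: "finite {x. poly p x = 0}"
    using Suc by (simp add: poly_roots_finite)
  have "(\<Sum>x | poly p x = 0. order x p) =
      (\<Sum>x | poly p x = 0. if x = a then 1 else 0) + (\<Sum>x | poly p x = 0. order x q)"
    by (simp add: ord sum.distrib)
  also have "(\<Sum>x | poly p x = 0. if x = a then 1 else 0) = (1::nat)"
    using a fin by simp
  also have "(\<Sum>x | poly p x = 0. order x q) = (\<Sum>x | poly q x = 0. order x q)"
    by (rule sum.mono_neutral_right[OF fin]) (auto simp: q order_0I)
  finally show ?case
    using IH deg by simp
qed

lemma degree_eq_0_if_no_root: "(\<And>x. poly p x \<noteq> 0) \<Longrightarrow> degree p = 0" for p :: "'b::alg_closed_field poly"
  using alg_closed_imp_poly_has_root[of p] by auto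

text \<open>Differentiation lowers a multiplicity by at most one. In positive characteristic it need
  not lower it at all, hence divisibility and not an equation of orders.\<close>

lemma linear_power_dvd_pderiv:
  fixes f :: "'b::idom poly"
  assumes "[:-a, 1:] ^ Suc n dvd f"
  shows "[:-a, 1:] ^ n dvd pderiv f"
proof -
  from assms obtain q where "f = [:-a, 1:] ^ Suc n * q"
    by (elim dvdE)
  hence "pderiv f = [:-a, 1:] ^ Suc n * pderiv q + q * (smult (of_nat (Suc n)) ([:-a, 1:] ^ n) * pderiv [:-a, 1:])"
    by (simp only: pderiv_mult pderiv_power_Suc)
  also have "\<dots> = [:-a, 1:] ^ n * ([:-a, 1:] * pderiv q + smult (of_nat (Suc n)) q)"
    by (simp add: pderiv_pCons distrib_left mult_ac del: of_nat_Suc mult_pCons_left mult_pCons_right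
        flip: one_pCons)
  finally have "pderiv f = [:-a, 1:] ^ n * ([:-a, 1:] * pderiv q + smult (of_nat (Suc n)) q)" .
  thus ?thesis
    by simp
qed

lemma degree_pderiv_le:
  fixes f :: "'b::idom poly"
  shows "degree (pderiv f) \<le> degree f - 1"
  by (rule degree_le) (auto simp: coeff_pderiv intro!: coeff_eq_0)

lemma degree_wronskian_le:
  fixes f k :: "'b::idom poly"
  assumes "degree f + degree k \<ge> 1"
  shows "degree (pderiv f * k - f * pderiv k) \<le> degree f + degree k - 1"
proof (rule degree_diff_le)
  have "degree (pderiv f * k) \<le> degree f + degree k - 1" for f k :: "'b poly"
  proof (cases "degree f = 0")
    case True
    thus ?thesis
      by (auto elim!: degree_eq_zeroE simp: pderiv_pCons)
  next
    case False
    have "degree (pderiv f * k) \<le> degree (pderiv f) + degree k"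
      by (rule degree_mult_le)
    moreover have "degree (pderiv f) \<le> degree f - 1"
      by (rule degree_pderiv_le)
    ultimately show ?thesis
      using False by linarith
  qed
  from this[of f k] this[of k f]
  show "degree (pderiv f * k) \<le> degree f + degree k - 1" "degree (f * pderiv k) \<le> degree f + degree k - 1"
    by (simp_all add: mult.commute add.commute)
qed

text \<open>The affine coordinate of the point with homogeneous coordinates \<open>[u : v]\<close>.
  The meaningless pair \<open>(0, 0)\<close> also gives \<open>None\<close>; in
  \<open>rational_map\<close> it is excluded by \<open>no_common_root\<close> and
  \<open>top\<close>.\<close>

definition proj_pt :: "'b::field \<Rightarrow> 'b \<Rightarrow> 'b option" where
  "proj_pt u v = (if v = 0 then None else Some (u / v))"

text \<open>
  The projective line is modelled by the option type, with \<^term>\<open>None\<close> as the point at infinity.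
\<close>

definition ratmap :: "'b::field poly \<Rightarrow> 'b poly \<Rightarrow> nat \<Rightarrow> 'b option \<Rightarrow> 'b option" where
  "ratmap g h d t = (case t of Some x \<Rightarrow> proj_pt (poly g x) (poly h x)
     | None \<Rightarrow> proj_pt (coeff g d) (coeff h d))"

text \<open>The roots are the finite points of the fibre over \<open>t\<close>, and the shortfall of
  the degree from \<open>d\<close> is the multiplicity of infinity in that fibre.\<close>

definition fibre_poly :: "'b::field poly \<Rightarrow> 'b poly \<Rightarrow> 'b option \<Rightarrow> 'b poly" where
  "fibre_poly g h t = (case t of None \<Rightarrow> h | Some \<beta> \<Rightarrow> g - smult \<beta> h)"

text \<open>Multiplicity in the own fibre, minus one. Within \<open>rational_map\<close> that
  multiplicity is positive, so the subtractions do not truncate.\<close>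

definition ramif :: "'b::field poly \<Rightarrow> 'b poly \<Rightarrow> nat \<Rightarrow> 'b option \<Rightarrow> nat" where
  "ramif g h d t = (case t of
     Some x \<Rightarrow> order x (fibre_poly g h (ratmap g h d t)) - 1
   | None \<Rightarrow> d - degree (fibre_poly g h (ratmap g h d t)) - 1)"

text \<open>\<open>top\<close> is the counterpart of \<open>no_common_root\<close> at infinity;
  together with the degree bounds it makes \<open>d\<close> the exact degree of the map.\<close>

locale rational_map =
  fixes g h :: "'b::alg_closed_field poly" and d :: nat
  assumes deg_g: "degree g \<le> d" and deg_h: "degree h \<le> d" and d_pos: "d \<ge> 1"
    and no_common_root: "poly g x \<noteq> 0 \<or> poly h x \<noteq> 0"
    and top: "coeff g d \<noteq> 0 \<or> coeff h d \<noteq> 0"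
begin

lemma ratmap_Some_eq_iff: "ratmap g h d (Some x) = t \<longleftrightarrow> poly (fibre_poly g h t) x = 0"
  using no_common_root[of x] by (cases t) (auto simp: ratmap_def proj_pt_def fibre_poly_def field_simps)

lemma degree_fibre_poly_le: "degree (fibre_poly g h t) \<le> d"
  using deg_g deg_h by (auto simp: fibre_poly_def intro!: degree_diff_le order.trans[OF degree_smult_le] split: option.splits)

lemma ratmap_None_eq_iff: "ratmap g h d None = t \<longleftrightarrow> degree (fibre_poly g h t) < d"
proof -
  have "ratmap g h d None = t \<longleftrightarrow> coeff (fibre_poly g h t) d = 0"
    using top by (cases t) (auto simp: ratmap_def proj_pt_def fibre_poly_def field_simps)
  also have "\<dots> \<longleftrightarrow> degree (fibre_poly g h t) < d"
  proof
    assume *: "coeff (fibre_poly g h t) d = 0"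
    have "degree (fibre_poly g h t) \<noteq> d"
    proof
      assume deg: "degree (fibre_poly g h t) = d"
      hence "fibre_poly g h t = 0"
        using * by (metis leading_coeff_0_iff)
      thus False
        using deg d_pos by simp
    qed
    thus "degree (fibre_poly g h t) < d"
      using degree_fibre_poly_le[of t] by linarith
  qed (rule coeff_eq_0)
  finally show ?thesis .
qed

text \<open>If it vanished, \<open>g\<close> and \<open>h\<close> would be multiples of one
  polynomial, whose roots would be common; so both would be constant, against \<open>top\<close>
  with \<open>d \<ge> 1\<close>.\<close>

lemma fibre_poly_nonzero: "fibre_poly g h t \<noteq> 0"
proof
  assume *: "fibre_poly g h t = 0"
  have "degree g = 0 \<and> degree h = 0"
  proof (cases t)
    case None
    hence "h = 0"
      using * by (simp add: fibre_poly_def)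
    thus ?thesis
      using no_common_root degree_eq_0_if_no_root[of g] by simp
  next
    case (Some \<beta>)
    hence g: "g = smult \<beta> h"
      using * by (simp add: fibre_poly_def)
    have "degree h = 0"
      using no_common_root by (intro degree_eq_0_if_no_root) (auto simp: g)
    thus ?thesis
      by (simp add: g)
  qed
  thus False
    using top d_pos coeff_eq_0[of g d] coeff_eq_0[of h d] by auto
qed

lemma vimage_ratmap:
  "ratmap g h d -` {t} = Some ` {x. poly (fibre_poly g h t) x = 0} \<union>
     (if degree (fibre_poly g h t) < d then {None} else {})"
proof (rule Set.set_eqI)
  fix y
  show "y \<in> ratmap g h d -` {t} \<longleftrightarrow> y \<in> Some ` {x. poly (fibre_poly g h t) x = 0} \<union>
     (if degree (fibre_poly g h t) < d then {None} else {})"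
    by (cases y) (auto simp: ratmap_Some_eq_iff ratmap_None_eq_iff)
qed

lemma finite_vimage_ratmap: "finite (ratmap g h d -` {t})"
  unfolding vimage_ratmap using poly_roots_finite[OF fibre_poly_nonzero] by simp

text \<open>Adding 1 to \<open>ramif\<close> gives multiplicities. The finite ones add up to the
  degree of the fibre polynomial, and infinity contributes exactly the missing
  \<open>d - degree f\<close>.\<close>

lemma card_vimage_ratmap:
  "card (ratmap g h d -` {t}) + sum (ramif g h d) (ratmap g h d -` {t}) = d"
proof -
  define f where "f = fibre_poly g h t"
  define Z where "Z = {x. poly f x = 0}"
  have f: "f \<noteq> 0" "finite Z"
    using fibre_poly_nonzero poly_roots_finite by (auto simp: f_def Z_def)
  have V: "ratmap g h d -` {t} = Some ` Z \<union> (if degree f < d then {None} else {})"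
    unfolding vimage_ratmap f_def Z_def ..
  have "(\<Sum>y\<in>ratmap g h d -` {t}. 1 + ramif g h d y) =
      (\<Sum>y\<in>Some ` Z. 1 + ramif g h d y) + (d - degree f)"
  proof (cases "degree f < d")
    case True
    hence "ratmap g h d None = t"
      by (simp add: ratmap_None_eq_iff f_def)
    hence "1 + ramif g h d None = d - degree f"
      using True by (simp add: ramif_def f_def)
    thus ?thesis
      using True f(2) by (simp add: V)
  next
    case False
    thus ?thesis
      by (simp add: V)
  qed
  also have "(\<Sum>y\<in>Some ` Z. 1 + ramif g h d y) = (\<Sum>x\<in>Z. 1 + ramif g h d (Some x))"
    by (subst sum.reindex) auto
  also have "\<dots> = (\<Sum>x\<in>Z. order x f)"
  proof (rule sum.cong[OF refl])
    fix x assume x: "x \<in> Z"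
    hence "ratmap g h d (Some x) = t"
      by (simp add: ratmap_Some_eq_iff f_def Z_def)
    moreover have "order x f > 0"
      using x f(1) by (simp add: order_gt_0_iff Z_def)
    ultimately show "1 + ramif g h d (Some x) = order x f"
      by (simp add: ramif_def f_def)
  qed
  also have "\<dots> = degree f"
    unfolding Z_def by (rule sum_order_eq_degree[OF f(1)])
  also have "degree f + (d - degree f) = d"
    using degree_fibre_poly_le[of t] by (simp add: f_def)
  finally show ?thesis
    unfolding sum.distrib by simp
qed

lemma vimage_ratmap_nonempty: "ratmap g h d -` {t} \<noteq> {}"
  using card_vimage_ratmap[of t] d_pos by (intro notI) simp

text \<open>The Wronskian is unchanged when \<open>g\<close> is replaced by
  \<open>g - \<beta> h\<close>, so the fibre polynomial \<open>f\<close> may take the place of one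
  of its two entries. A root of \<open>f\<close> of multiplicity \<open>k + 1\<close> is a root of
  \<open>f\<close> and of \<open>pderiv f\<close> of multiplicity at least \<open>k\<close>.\<close>

lemma ramif_le_order_wronskian:
  assumes "pderiv g * h - g * pderiv h \<noteq> 0"
  shows "ramif g h d (Some x) \<le> order x (pderiv g * h - g * pderiv h)"
proof -
  define t where "t = ratmap g h d (Some x)"
  define f where "f = fibre_poly g h t"
  define k where "k = ramif g h d (Some x)"
  have "f \<noteq> 0"
    by (simp add: f_def fibre_poly_nonzero)
  moreover have "poly f x = 0"
    by (simp add: f_def t_def flip: ratmap_Some_eq_iff)
  ultimately have "order x f > 0"
    by (simp add: order_gt_0_iff)
  hence "Suc k = order x f"
    by (simp add: k_def ramif_def f_def t_def)
  hence dvd: "[:-x, 1:] ^ Suc k dvd f"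
    by (simp add: order_1 del: power_Suc)
  have "[:-x, 1:] ^ k dvd f"
    by (rule dvd_trans[OF le_imp_power_dvd dvd]) simp
  moreover have "[:-x, 1:] ^ k dvd pderiv f"
    by (rule linear_power_dvd_pderiv[OF dvd])
  moreover have "pderiv g * h - g * pderiv h =
      (if t = None then pderiv g * f - g * pderiv f else pderiv f * h - f * pderiv h)"
    by (auto simp: f_def fibre_poly_def pderiv_diff pderiv_smult algebra_simps)
  ultimately have "[:-x, 1:] ^ k dvd pderiv g * h - g * pderiv h"
    by (auto intro!: dvd_diff)
  thus ?thesis
    using assms by (simp add: order_divides k_def)
qed

text \<open>The same substitution, applied to degrees: the Wronskian has degree at most
  \<open>degree f + d - 1\<close>, while the ramification at infinity is
  \<open>d - degree f - 1\<close>.\<close>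

lemma ramif_None_add_degree_wronskian:
  "ramif g h d None + degree (pderiv g * h - g * pderiv h) \<le> 2 * d - 2"
proof -
  define t where "t = ratmap g h d None"
  define f where "f = fibre_poly g h t"
  define W where "W = pderiv g * h - g * pderiv h"
  have less: "degree f < d"
    by (simp add: f_def t_def flip: ratmap_None_eq_iff)
  have k: "ramif g h d None = d - degree f - 1"
    by (simp add: ramif_def f_def t_def)
  have "degree W \<le> degree f + d - 1"
  \<comment> \<open>The case set apart is that of two constant entries in the Wronskian; it would
    force \<open>g\<close> and \<open>h\<close> to be constant.\<close>
  proof (cases "degree f = 0 \<and> (degree g = 0 \<and> t = None \<or> degree h = 0 \<and> t \<noteq> None)")
    case False
    show ?thesis
    proof (cases t)
      case None
      hence "W = -(pderiv f * g - f * pderiv g)"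
        by (simp add: W_def f_def fibre_poly_def)
      hence "degree W = degree (pderiv f * g - f * pderiv g)"
        by (simp only: degree_minus)
      also have "\<dots> \<le> degree f + degree g - 1"
        using False None by (intro degree_wronskian_le) auto
      finally show ?thesis
        using deg_g by linarith
    next
      case (Some \<beta>)
      hence "W = pderiv f * h - f * pderiv h"
        by (simp add: W_def f_def fibre_poly_def pderiv_diff pderiv_smult algebra_simps)
      also have "degree \<dots> \<le> degree f + degree h - 1"
        using False Some by (intro degree_wronskian_le) auto
      finally show ?thesis
        using deg_h by linarith
    qed
  next
    case True
    hence "degree g = 0 \<and> degree h = 0"
    proof (cases t)
      case (Some \<beta>)
      have "g = f + smult \<beta> h"
        using Some by (simp add: f_def fibre_poly_def)
      hence "degree g \<le> 0"
        using True Some degree_add_le[of f 0 "smult \<beta> h"] degree_smult_le[of \<beta> h] by simp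
      thus ?thesis
        using True Some by simp
    qed (use True in \<open>auto simp: f_def fibre_poly_def\<close>)
    thus ?thesis
      using top d_pos coeff_eq_0[of g d] coeff_eq_0[of h d] by auto
  qed
  thus ?thesis
    using k less unfolding W_def by linarith
qed

text \<open>Finite ramification is charged to the roots of the Wronskian, that at infinity to the
  gap between its degree and \<open>2 * d - 2\<close>. Wild ramification can make this strict, so
  only an inequality is stated.\<close>

lemma sum_ramif_le:
  assumes W: "pderiv g * h - g * pderiv h \<noteq> 0" and "finite Y"
  shows "None \<notin> Y \<Longrightarrow> sum (ramif g h d) Y \<le> degree (pderiv g * h - g * pderiv h)"
    and "sum (ramif g h d) Y \<le> 2 * d - 2"
proof -
  define W where "W = pderiv g * h - g * pderiv h"
  have *: "sum (ramif g h d) Y \<le> degree W" if "None \<notin> Y" "finite Y" for Y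
  proof -
    have Y: "Y = Some ` {x. Some x \<in> Y}"
      using that(1) by (auto simp: image_iff) (metis not_None_eq)
    have fin: "finite {x. Some x \<in> Y}"
      using that(2) by (metis Y finite_imageD inj_Some)
    have "sum (ramif g h d) Y = (\<Sum>x | Some x \<in> Y. ramif g h d (Some x))"
      by (subst Y, subst sum.reindex) auto
    also have "\<dots> \<le> (\<Sum>x | Some x \<in> Y. order x W)"
      unfolding W_def by (intro sum_mono ramif_le_order_wronskian W)
    also have "\<dots> = (\<Sum>x\<in>{x. Some x \<in> Y} \<inter> {x. poly W x = 0}. order x W)"
      by (rule sum.mono_neutral_right[OF fin]) (auto simp: order_0I)
    also have "\<dots> \<le> (\<Sum>x | poly W x = 0. order x W)"
      using W poly_roots_finite[of W] by (intro sum_mono2) (auto simp: W_def)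
    also have "\<dots> = degree W"
      by (rule sum_order_eq_degree) (use W in \<open>simp add: W_def\<close>)
    finally show ?thesis .
  qed
  show "None \<notin> Y \<Longrightarrow> sum (ramif g h d) Y \<le> degree (pderiv g * h - g * pderiv h)"
    using *[OF _ assms(2)] by (simp add: W_def)
  have "sum (ramif g h d) Y \<le> sum (ramif g h d) (insert None (Y - {None}))"
    using assms(2) by (intro sum_mono2) auto
  also have "\<dots> = ramif g h d None + sum (ramif g h d) (Y - {None})"
    using assms(2) by (subst sum.insert) auto
  also have "\<dots> \<le> ramif g h d None + degree W"
    using *[of "Y - {None}"] assms(2) by simp
  also have "\<dots> \<le> 2 * d - 2"
    unfolding W_def by (rule ramif_None_add_degree_wronskian)
  finally show "sum (ramif g h d) Y \<le> 2 * d - 2" .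
qed

lemma degree_wronskian_le_2d: "degree (pderiv g * h - g * pderiv h) \<le> 2 * d - 2"
  using ramif_None_add_degree_wronskian by simp

end

subsection \<open>Composition and iteration of rational functions\<close>

text \<open>A nonzero element \<open>m\<close> of least degree in the ideal of \<open>g\<close> and
  \<open>h\<close> divides the whole ideal, by division with remainder, and is therefore a
  unit.\<close>

lemma field_poly_bezout:
  fixes g h :: "'a::field poly"
  assumes "coprime g h"
  obtains a b where "a * g + b * h = 1"
proof -
  define I where "I = {z. \<exists>a b. z = a * g + b * h}"
  have gI: "g \<in> I" and hI: "h \<in> I"
    unfolding I_def by (auto intro: exI[of _ 1] exI[of _ 0])
  have "g \<noteq> 0 \<or> h \<noteq> 0"
    using assms by auto
  then obtain z where "z \<in> I \<and> z \<noteq> 0"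
    using gI hI by blast
  define m where "m = arg_min degree (\<lambda>z. z \<in> I \<and> z \<noteq> 0)"
  have m: "m \<in> I \<and> m \<noteq> 0"
    unfolding m_def by (rule arg_min_natI) fact
  have min: "degree m \<le> degree z" if "z \<in> I \<and> z \<noteq> 0" for z
    unfolding m_def using that by (rule arg_min_nat_le)
  from m obtain a b where ab: "m = a * g + b * h"
    by (auto simp: I_def)
  have "m dvd z" if zI: "z \<in> I" for z
  proof -
    from zI obtain a' b' where "z = a' * g + b' * h"
      by (auto simp: I_def)
    hence "z mod m = (a' - z div m * a) * g + (b' - z div m * b) * h"
      by (simp add: minus_div_mult_eq_mod[symmetric] ab algebra_simps)
    hence "z mod m \<in> I"
      by (auto simp: I_def)
    hence "z mod m = 0"
      using min[of "z mod m"] degree_mod_less[of m z] m by (cases "z mod m = 0") auto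
    thus ?thesis
      by (simp add: mod_eq_0_iff_dvd)
  qed
  hence "m dvd 1"
    using assms gI hI by (meson coprime_common_divisor)
  then obtain c where "1 = m * c"
    by (elim dvdE)
  hence "c * a * g + c * b * h = 1"
    by (simp add: ab algebra_simps)
  thus ?thesis
    by (rule that)
qed

section \<open>Base change to the algebraic closure and lowest terms\<close>

abbreviation pac :: "'a::field poly \<Rightarrow> 'a alg_closure poly" where
  "pac \<equiv> map_poly to_ac"

lemma coeff_pac [simp]: "coeff (pac p) i = to_ac (coeff p i)"
  by (simp add: coeff_map_poly)

lemma pac_add [simp]: "pac (p + q) = pac p + pac q"
  and pac_diff [simp]: "pac (p - q) = pac p - pac q"
  and pac_mult [simp]: "pac (p * q) = pac p * pac q"
  and pac_smult [simp]: "pac (smult c p) = smult (to_ac c) (pac p)"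
  and pac_pderiv: "pac (pderiv p) = pderiv (pac p)"
  by (rule poly_eqI; simp add: coeff_mult to_ac_sum coeff_pderiv)+

lemma pac_power [simp]: "pac (p ^ n) = pac p ^ n"
  by (induction n) simp_all

lemma pac_sum: "pac (sum f I) = (\<Sum>i\<in>I. pac (f i))"
  by (induction I rule: infinite_finite_induct) simp_all

lemma degree_pac [simp]: "degree (pac p) = degree p"
  by (rule degree_map_poly) auto

lemma pac_eq_0_iff [simp]: "pac p = 0 \<longleftrightarrow> p = 0"
  by (rule map_poly_eq_0_iff) auto

lemma coprime_no_common_root:
  assumes "coprime g h"
  shows "poly (pac g) x \<noteq> 0 \<or> poly (pac h) x \<noteq> 0"
proof -
  obtain a b where "a * g + b * h = 1"
    using field_poly_bezout[OF assms] .
  hence "poly (pac (a * g + b * h)) x = 1"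
    by simp
  thus ?thesis
    by (auto simp del: pac_power)
qed

lemma coprime_if_no_common_root:
  fixes g h :: "'a::field poly"
  assumes "\<And>x. poly (pac g) x \<noteq> 0 \<or> poly (pac h) x \<noteq> 0"
  shows "coprime g h"
proof (rule coprimeI)
  fix c assume c: "c dvd g" "c dvd h"
  have "c \<noteq> 0"
    using c assms[of 0] by auto
  have "degree c = 0"
  proof (rule ccontr)
    assume "degree c \<noteq> 0"
    then obtain x where "poly (pac c) x = 0"
      using alg_closed_imp_poly_has_root[of "pac c"] by auto
    with c assms[of x] show False
      by (auto elim!: dvdE)
  qed
  thus "is_unit c"
    using \<open>c \<noteq> 0\<close> by (simp add: is_unit_iff_degree)
qed

text \<open>By Bezout, the cross-multiplied equation makes each denominator divide the other, so
  they differ by a unit, which is a constant.\<close>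

lemma Fract_coprime_unique:
  fixes G H G' H' :: "'a::field poly"
  assumes eq: "Fract G H = Fract G' H'" and H: "H \<noteq> 0" "H' \<noteq> 0"
    and cop: "coprime G H" "coprime G' H'"
  obtains u where "u \<noteq> 0" "G' = smult u G" "H' = smult u H"
proof -
  have cross: "G * H' = G' * H"
    using eq H by (simp add: eq_fract)
  have dvd: "H dvd H'" if cop: "coprime G H" and cr: "G * H' = G' * H" for G H G' H' :: "'a poly"
  proof -
    obtain a b where "a * G + b * H = 1"
      using field_poly_bezout[OF cop] .
    hence "H' = (a * G + b * H) * H'"
      by simp
    also have "\<dots> = a * (G * H') + b * H * H'"
      by (simp add: algebra_simps)
    also have "\<dots> = H * (a * G' + b * H')"
      unfolding cr by (simp add: algebra_simps)
    finally show ?thesis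
      by (rule dvdI)
  qed
  obtain c where c: "H' = H * c"
    using dvd[OF cop(1) cross] by (elim dvdE)
  have "H' dvd H"
    using dvd[OF cop(2) cross[symmetric]] .
  hence "is_unit c"
    using c H by (metis dvd_mult_cancel_left mult.right_neutral)
  then obtain u where u: "c = [:u:]" "u \<noteq> 0"
    by (auto simp: is_unit_poly_iff dvd_field_iff)
  have "G' = G * c"
    using cross H(1) unfolding c by (simp add: algebra_simps)
  thus ?thesis
    using that[of u] u c by simp
qed

text \<open>This resolves the definite descriptions once and for all. Any representation in lowest
  terms may be used from here on, at the price of a scalar \<open>u\<close> that cancels in every
  quotient.\<close>

lemma rat_num_den_Fract:
  fixes G H :: "'a::field poly"
  assumes R: "R = Fract G H" and H: "H \<noteq> 0" and cop: "coprime G H"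
  obtains u where "u \<noteq> 0" "rat_num R = smult u G" "rat_den R = smult u H"
proof -
  define u where "u = inverse (lead_coeff H)"
  have u: "u \<noteq> 0"
    using H by (simp add: u_def)
  have cop': "coprime (smult u G) (smult u H)"
    using u cop by (simp add: coprime_def dvd_smult_iff)
  have eq': "R = Fract (smult u G) (smult u H)"
    using u H by (simp add: R eq_fract)
  have den: "rat_den R = smult u H"
    unfolding rat_den_def
  proof (rule the_equality)
    show "lead_coeff (smult u H) = 1 \<and> (\<exists>G. coprime G (smult u H) \<and> R = Fract G (smult u H))"
      using H cop' eq' by (auto simp: u_def)
    fix H' assume *: "lead_coeff H' = 1 \<and> (\<exists>G. coprime G H' \<and> R = Fract G H')"
    then obtain G' where G': "coprime G' H'" "R = Fract G' H'"
      by blast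
    have "H' \<noteq> 0"
      using * by auto
    obtain v where v: "v \<noteq> 0" "H' = smult v H"
      using Fract_coprime_unique[OF _ H \<open>H' \<noteq> 0\<close> cop G'(1)] G'(2) R by metis
    hence "v * lead_coeff H = 1"
      using * by simp
    hence "v = u"
      using H by (simp add: u_def field_simps)
    thus "H' = smult u H"
      using v by simp
  qed
  have "rat_num R = smult u G"
    unfolding rat_num_def den
  proof (rule the_equality)
    show "coprime (smult u G) (smult u H) \<and> R = Fract (smult u G) (smult u H)"
      using cop' eq' by simp
    fix G' assume "coprime G' (smult u H) \<and> R = Fract G' (smult u H)"
    hence "Fract G' (smult u H) = Fract (smult u G) (smult u H)"
      using eq' by simp
    hence "G' * smult u H = smult u G * smult u H"
      using u H by (subst (asm) eq_fract) auto
    thus "G' = smult u G"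
      using u H by (metis mult_right_cancel smult_eq_0_iff)
  qed
  with den u show ?thesis
    by (intro that[of u])
qed

section \<open>Binary forms and composition on the projective line\<close>

definition hom_eval :: "nat \<Rightarrow> 'b::comm_semiring_1 poly \<Rightarrow> 'b \<Rightarrow> 'b \<Rightarrow> 'b" where
  "hom_eval D p u v = (\<Sum>i\<le>D. coeff p i * (u ^ i * v ^ (D - i)))"

lemma hom_eval_eq_poly:
  fixes u v :: "'b::field"
  assumes "degree p \<le> D" "v \<noteq> 0"
  shows "hom_eval D p u v = v ^ D * poly p (u / v)"
proof -
  have "hom_eval D p u v = (\<Sum>i\<le>D. v ^ D * (coeff p i * (u / v) ^ i))"
    unfolding hom_eval_def
  proof (rule sum.cong[OF refl])
    fix i assume "i \<in> {..D}"
    hence "v ^ D = v ^ i * v ^ (D - i)"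
      by (simp flip: power_add)
    thus "coeff p i * (u ^ i * v ^ (D - i)) = v ^ D * (coeff p i * (u / v) ^ i)"
      using assms(2) by (simp add: power_divide)
  qed
  also have "\<dots> = v ^ D * (\<Sum>i\<le>D. coeff p i * (u / v) ^ i)"
    by (simp add: sum_distrib_left)
  also have "(\<Sum>i\<le>D. coeff p i * (u / v) ^ i) = poly p (u / v)"
    unfolding poly_altdef using assms(1) by (intro sum.mono_neutral_right) (auto simp: coeff_eq_0)
  finally show ?thesis .
qed

lemma hom_eval_infinity: "hom_eval D p u 0 = coeff p D * u ^ D"
proof -
  have "hom_eval D p u 0 = (\<Sum>i\<in>{D}. coeff p i * (u ^ i * 0 ^ (D - i)))"
    \<comment> \<open>As \<open>0 ^ 0 = 1\<close>, only the summand with \<open>i = D\<close>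
      survives.\<close>
    unfolding hom_eval_def by (rule sum.mono_neutral_right) (auto simp: power_0_left split: if_splits)
  thus ?thesis
    by simp
qed

lemma ratmap_proj_pt:
  assumes "degree p \<le> D" "degree q \<le> D" "u \<noteq> 0 \<or> v \<noteq> 0"
  shows "ratmap p q D (proj_pt u v) = proj_pt (hom_eval D p u v) (hom_eval D q u v)"
proof (cases "v = 0")
  case True
  thus ?thesis
    using assms(3) by (simp add: ratmap_def proj_pt_def hom_eval_infinity)
next
  case False
  thus ?thesis
    using assms(1,2) by (simp add: ratmap_def proj_pt_def hom_eval_eq_poly)
qed

text \<open>The numerator \<open>H ^ D * p (G / H)\<close> of a substitution, written without
  division. \<open>D\<close> may exceed the degree of \<open>p\<close>, so numerator and denominator
  of a rational function can share one \<open>D\<close>.\<close>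

definition homogenize :: "nat \<Rightarrow> 'a::field poly \<Rightarrow> 'a poly \<Rightarrow> 'a poly \<Rightarrow> 'a poly" where
  "homogenize D p G H = (\<Sum>i\<le>D. smult (coeff p i) (G ^ i * H ^ (D - i)))"

lemma poly_pac_homogenize:
  "poly (pac (homogenize D p G H)) x = hom_eval D (pac p) (poly (pac G) x) (poly (pac H) x)"
  by (simp add: homogenize_def hom_eval_def pac_sum poly_sum)

text \<open>\<open>m\<close> and \<open>n\<close> are formal degrees: either coefficient may vanish,
  as it does for one of numerator and denominator when infinity goes to 0 or to infinity.\<close>

lemma coeff_mult_top:
  fixes p q :: "'b::comm_semiring_0 poly"
  assumes "degree p \<le> m" "degree q \<le> n"
  shows "coeff (p * q) (m + n) = coeff p m * coeff q n"
proof -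
  have "coeff (p * q) (m + n) = (\<Sum>i\<le>m + n. coeff p i * coeff q (m + n - i))"
    by (rule coeff_mult)
  also have "\<dots> = (\<Sum>i\<in>{m}. coeff p i * coeff q (m + n - i))"
  proof (rule sum.mono_neutral_right)
    show "\<forall>i\<in>{..m + n} - {m}. coeff p i * coeff q (m + n - i) = 0"
    proof
      fix i assume "i \<in> {..m + n} - {m}"
      hence "i > m \<or> m + n - i > n"
        by auto
      thus "coeff p i * coeff q (m + n - i) = 0"
        using assms coeff_eq_0[of p i] coeff_eq_0[of q "m + n - i"] by auto
    qed
  qed auto
  finally show ?thesis
    by simp
qed

lemma degree_power_le': "degree p \<le> m \<Longrightarrow> degree (p ^ i) \<le> i * m"
  by (rule order.trans[OF degree_power_le]) simp

lemma coeff_power_top: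
  fixes p :: "'b::comm_semiring_1 poly"
  assumes "degree p \<le> m"
  shows "coeff (p ^ i) (i * m) = coeff p m ^ i"
  using assms by (induction i) (simp_all add: coeff_mult_top degree_power_le')

lemma
  assumes "degree G \<le> \<delta>" "degree H \<le> \<delta>"
  shows degree_homogenize_le: "degree (homogenize D p G H) \<le> D * \<delta>"
    and coeff_homogenize: "coeff (homogenize D p G H) (D * \<delta>) = hom_eval D p (coeff G \<delta>) (coeff H \<delta>)"
proof -
  have D: "D * \<delta> = i * \<delta> + (D - i) * \<delta>" if "i \<le> D" for i
    using that by (simp flip: add_mult_distrib)
  have "degree (smult (coeff p i) (G ^ i * H ^ (D - i))) \<le> D * \<delta>" if "i \<le> D" for i
  proof -
    have "degree (smult (coeff p i) (G ^ i * H ^ (D - i))) \<le> degree (G ^ i) + degree (H ^ (D - i))"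
      by (rule order.trans[OF degree_smult_le degree_mult_le])
    also have "\<dots> \<le> i * \<delta> + (D - i) * \<delta>"
      by (intro add_mono degree_power_le' assms)
    finally show ?thesis
      using D[OF that] by simp
  qed
  thus "degree (homogenize D p G H) \<le> D * \<delta>"
    unfolding homogenize_def by (intro degree_sum_le) auto
  show "coeff (homogenize D p G H) (D * \<delta>) = hom_eval D p (coeff G \<delta>) (coeff H \<delta>)"
    unfolding homogenize_def hom_eval_def coeff_sum
  proof (rule sum.cong[OF refl])
    fix i assume "i \<in> {..D}"
    hence "coeff (G ^ i * H ^ (D - i)) (D * \<delta>) = coeff G \<delta> ^ i * coeff H \<delta> ^ (D - i)"
      using D[of i] assms by (simp add: coeff_mult_top coeff_power_top degree_power_le')
    thus "coeff (smult (coeff p i) (G ^ i * H ^ (D - i))) (D * \<delta>) =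
        coeff p i * (coeff G \<delta> ^ i * coeff H \<delta> ^ (D - i))"
      by simp
  qed
qed

lemma Fract_sum:
  "finite I \<Longrightarrow> b \<noteq> 0 \<Longrightarrow> (\<Sum>i\<in>I. Fract (f i) b) = Fract (\<Sum>i\<in>I. f i) b"
  by (induction I rule: finite_induct) (auto simp: fract_collapse eq_fract algebra_simps)

lemma Fract_power: "b \<noteq> 0 \<Longrightarrow> Fract a b ^ n = Fract (a ^ n) (b ^ n)"
  by (induction n) (simp_all add: fract_expand)

lemma rat_subst_Fract:
  assumes "H \<noteq> 0" "degree P \<le> D"
  shows "rat_subst P (Fract G H) = Fract (homogenize D P G H) (H ^ D)"
proof -
  let ?c = "\<lambda>c. Fract [:c:] 1"
  have deg: "degree (map_poly ?c P) \<le> D"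
    using assms(2) by (intro order.trans[OF map_poly_degree_leq]) (auto simp: fract_collapse)
  have "rat_subst P (Fract G H) = (\<Sum>i\<le>D. coeff (map_poly ?c P) i * Fract G H ^ i)"
    unfolding rat_subst_def poly_altdef using deg
    by (intro sum.mono_neutral_left) (auto simp: coeff_eq_0)
  also have "\<dots> = (\<Sum>i\<le>D. Fract (smult (coeff P i) (G ^ i * H ^ (D - i))) (H ^ D))"
  proof (rule sum.cong[OF refl])
    fix i assume "i \<in> {..D}"
    hence "H ^ D = H ^ i * H ^ (D - i)"
      by (simp flip: power_add)
    thus "coeff (map_poly ?c P) i * Fract G H ^ i = Fract (smult (coeff P i) (G ^ i * H ^ (D - i))) (H ^ D)"
      using assms(1) by (simp add: coeff_map_poly fract_collapse Fract_power eq_fract mult_ac)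
  qed
  also have "\<dots> = Fract (homogenize D P G H) (H ^ D)"
    unfolding homogenize_def using assms(1) by (intro Fract_sum) auto
  finally show ?thesis .
qed

text \<open>Lowest terms without a normalised denominator. The condition \<open>\<delta> > 0\<close>
  excludes constants, so every such function acts on the projective line with nonempty finite
  fibres.\<close>

definition represents :: "'a::field poly fract \<Rightarrow> 'a poly \<Rightarrow> 'a poly \<Rightarrow> nat \<Rightarrow> bool" where
  "represents R G H \<delta> \<longleftrightarrow> R = Fract G H \<and> H \<noteq> 0 \<and> coprime G H \<and> \<delta> = max (degree G) (degree H) \<and> \<delta> > 0"

lemma represents_num_den:
  assumes "represents R G H \<delta>"
  obtains u where "u \<noteq> 0" "rat_num R = smult u G" "rat_den R = smult u H"
  using assms rat_num_den_Fract[of R G H] unfolding represents_def by blast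

abbreviation ratmap_ac :: "'a::field poly \<Rightarrow> 'a poly \<Rightarrow> nat \<Rightarrow> 'a alg_closure option \<Rightarrow> 'a alg_closure option" where
  "ratmap_ac G H \<equiv> ratmap (pac G) (pac H)"

lemma max_degree_eqI:
  assumes "degree G \<le> \<delta>" "degree H \<le> \<delta>" "coeff G \<delta> \<noteq> 0 \<or> coeff H \<delta> \<noteq> 0"
  shows "\<delta> = max (degree G) (degree H)"
  using assms le_degree[of G \<delta>] le_degree[of H \<delta>] by (auto simp: max_def)

lemma coeff_max_degree_nonzero:
  assumes "\<delta> = max (degree G) (degree H)" "H \<noteq> 0" "\<delta> > 0"
  shows "coeff G \<delta> \<noteq> 0 \<or> coeff H \<delta> \<noteq> 0"
proof (cases "degree G \<le> degree H")
  case False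
  hence "G \<noteq> 0"
    by auto
  with False show ?thesis
    using assms by (auto simp: max_def)
qed (use assms in \<open>auto simp: max_def\<close>)

lemma rational_map_pac:
  assumes "represents R G H \<delta>"
  shows "rational_map (pac G) (pac H) \<delta>"
proof
  show "poly (pac G) x \<noteq> 0 \<or> poly (pac H) x \<noteq> 0" for x
    using assms coprime_no_common_root by (auto simp: represents_def)
  show "coeff (pac G) \<delta> \<noteq> 0 \<or> coeff (pac H) \<delta> \<noteq> 0"
    using assms coeff_max_degree_nonzero[of \<delta> G H] by (auto simp: represents_def)
qed (use assms in \<open>auto simp: represents_def\<close>)

lemma hom_eval_no_common_zero:
  assumes rep: "represents F P Q D" and uv: "u \<noteq> 0 \<or> v \<noteq> 0"
  shows "hom_eval D (pac P) u v \<noteq> 0 \<or> hom_eval D (pac Q) u v \<noteq> 0"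
proof -
  interpret rational_map "pac P" "pac Q" D
    by (rule rational_map_pac[OF rep])
  show ?thesis
  proof (cases "v = 0")
    case True
    thus ?thesis
      using uv top by (simp add: hom_eval_infinity)
  next
    case False
    thus ?thesis
      using no_common_root[of "u / v"] deg_g deg_h by (simp add: hom_eval_eq_poly)
  qed
qed

lemma to_ac_hom_eval: "to_ac (hom_eval D p u v) = hom_eval D (pac p) (to_ac u) (to_ac v)"
  by (simp add: hom_eval_def to_ac_sum)

text \<open>The two forms of \<open>F\<close> have no common zero on the projective line, so
  substituting the forms of \<open>R\<close> causes no cancellation. Hence degrees multiply, and
  formal composition in $K(x)$ agrees with composition of maps even through poles.\<close>

lemma represents_rat_comp:
  assumes F: "represents F P Q D" and R: "represents R G H \<delta>"
  shows "represents (rat_comp F R) (homogenize D P G H) (homogenize D Q G H) (D * \<delta>)"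
    and "ratmap_ac (homogenize D P G H) (homogenize D Q G H) (D * \<delta>) t =
      ratmap_ac P Q D (ratmap_ac G H \<delta> t)"
proof -
  interpret F: rational_map "pac P" "pac Q" D
    by (rule rational_map_pac[OF F])
  interpret R: rational_map "pac G" "pac H" \<delta>
    by (rule rational_map_pac[OF R])
  have degs: "degree P \<le> D" "degree Q \<le> D" "degree G \<le> \<delta>" "degree H \<le> \<delta>"
    using F.deg_g F.deg_h R.deg_g R.deg_h by auto
  have H: "H \<noteq> 0" "R = Fract G H"
    using R by (auto simp: represents_def)
  let ?P = "homogenize D P G H" and ?Q = "homogenize D Q G H"
  \<comment> \<open>At infinity the homogeneous coordinates of the image under \<open>R\<close> are
    the formal leading coefficients of \<open>G\<close> and \<open>H\<close>.\<close>
  have top: "coeff ?P (D * \<delta>) \<noteq> 0 \<or> coeff ?Q (D * \<delta>) \<noteq> 0"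
  proof -
    have "hom_eval D (pac P) (to_ac (coeff G \<delta>)) (to_ac (coeff H \<delta>)) \<noteq> 0 \<or>
        hom_eval D (pac Q) (to_ac (coeff G \<delta>)) (to_ac (coeff H \<delta>)) \<noteq> 0"
      using R.top by (intro hom_eval_no_common_zero[OF F]) auto
    thus ?thesis
      using degs by (simp add: coeff_homogenize flip: to_ac_hom_eval)
  qed
  have ncr: "poly (pac ?P) x \<noteq> 0 \<or> poly (pac ?Q) x \<noteq> 0" for x
    unfolding poly_pac_homogenize using R.no_common_root[of x]
    by (intro hom_eval_no_common_zero[OF F]) auto
  hence cop: "coprime ?P ?Q"
    by (intro coprime_if_no_common_root)
  have max: "D * \<delta> = max (degree ?P) (degree ?Q)"
    using top degs by (intro max_degree_eqI degree_homogenize_le)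
  have pos: "D * \<delta> > 0"
    using F.d_pos R.d_pos by simp
  have Q0: "?Q \<noteq> 0"
  proof
    assume *: "?Q = 0"
    hence "degree ?P > 0"
      using max pos by simp
    then obtain x where "poly (pac ?P) x = 0"
      using alg_closed_imp_poly_has_root[of "pac ?P"] by auto
    thus False
      using ncr[of x] * by simp
  qed
  obtain u where u: "u \<noteq> 0" "rat_num F = smult u P" "rat_den F = smult u Q"
    using represents_num_den[OF F] .
  have "rat_comp F R = Fract ?P ?Q"
  proof -
    have hs: "homogenize D (smult u p) G H = smult u (homogenize D p G H)" for p
      by (rule poly_eqI) (simp add: homogenize_def coeff_sum sum_distrib_left mult_ac)
    show ?thesis
      unfolding rat_comp_def u H(2) using degs u(1) H(1) Q0
      by (simp add: rat_subst_Fract[where D = D] hs eq_fract mult_ac)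
  qed
  thus "represents (rat_comp F R) ?P ?Q (D * \<delta>)"
    using Q0 cop max pos by (simp add: represents_def)
  show "ratmap_ac ?P ?Q (D * \<delta>) t = ratmap_ac P Q D (ratmap_ac G H \<delta> t)"
  proof (cases t)
    case None
    have "ratmap_ac ?P ?Q (D * \<delta>) t = proj_pt (hom_eval D (pac P) (to_ac (coeff G \<delta>)) (to_ac (coeff H \<delta>)))
        (hom_eval D (pac Q) (to_ac (coeff G \<delta>)) (to_ac (coeff H \<delta>)))"
      using None degs by (simp add: ratmap_def coeff_homogenize to_ac_hom_eval)
    also have "\<dots> = ratmap_ac P Q D (proj_pt (to_ac (coeff G \<delta>)) (to_ac (coeff H \<delta>)))"
      using R.top degs by (intro ratmap_proj_pt[symmetric]) auto
    finally show ?thesis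
      using None by (simp add: ratmap_def[of "pac G"])
  next
    case (Some x)
    have "ratmap_ac ?P ?Q (D * \<delta>) t = proj_pt (hom_eval D (pac P) (poly (pac G) x) (poly (pac H) x))
        (hom_eval D (pac Q) (poly (pac G) x) (poly (pac H) x))"
      using Some by (simp add: ratmap_def poly_pac_homogenize)
    also have "\<dots> = ratmap_ac P Q D (proj_pt (poly (pac G) x) (poly (pac H) x))"
      using R.no_common_root[of x] degs by (intro ratmap_proj_pt[symmetric]) auto
    finally show ?thesis
      using Some by (simp add: ratmap_def[of "pac G"])
  qed
qed

text \<open>This turns formal iterates into plain function iteration. The numerators, denominators
  and degrees stay existential, as only the induced maps are used later.\<close>

lemma rat_iter_represents:
  assumes R: "represents R G H \<delta>"
  shows "\<exists>P Q D. represents (rat_iter R n) P Q D \<and> ratmap_ac P Q D = ratmap_ac G H \<delta> ^^ n"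
proof (induction n)
  case 0
  have "represents (rat_iter R 0) [:0, 1:] 1 1"
    by (simp add: represents_def)
  moreover have "ratmap_ac [:0, 1:] (1 :: 'a poly) 1 = id"
    by (rule ext, rename_tac t, case_tac t) (auto simp: ratmap_def proj_pt_def map_poly_pCons)
  ultimately show ?case
    by (metis funpow_0 id_apply ext)
next
  case (Suc n)
  then obtain P Q D where "represents (rat_iter R n) P Q D" "ratmap_ac P Q D = ratmap_ac G H \<delta> ^^ n"
    by blast
  with represents_rat_comp[OF this(1) R] show ?case
    by (intro exI conjI) (auto simp: fun_eq_iff funpow_swap1)
qed

lemma rat_has_value_iff_ratmap:
  assumes "represents R G H \<delta>"
  shows "rat_has_value R x y \<longleftrightarrow> ratmap_ac G H \<delta> (Some x) = Some y"
proof -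
  obtain u where u: "u \<noteq> 0" "rat_num R = smult u G" "rat_den R = smult u H"
    using represents_num_den[OF assms] .
  thus ?thesis
    by (auto simp: rat_has_value_def ratmap_def proj_pt_def)
qed

lemma rat_iter_has_value_iff:
  assumes "represents R G H \<delta>"
  shows "rat_has_value (rat_iter R n) x y \<longleftrightarrow> (ratmap_ac G H \<delta> ^^ n) (Some x) = Some y"
  using rat_iter_represents[OF assms, of n] by (metis rat_has_value_iff_ratmap)

lemma rat_degree_Fract:
  fixes G H :: "'a::field poly"
  assumes "R = Fract G H" "H \<noteq> 0" "coprime G H"
  shows "rat_degree R = max (degree G) (degree H)"
proof -
  obtain u where "u \<noteq> 0" "rat_num R = smult u G" "rat_den R = smult u H"
    using rat_num_den_Fract[OF assms] .
  thus ?thesis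
    by (simp add: rat_degree_def)
qed

subsection \<open>Conjugate elements\<close>

lemma pderiv_eq_0_CHAR_0:
  fixes f :: "'a::field poly"
  assumes "CHAR('a) = 0" "pderiv f = 0"
  shows "degree f = 0"
proof (rule ccontr)
  assume "degree f \<noteq> 0"
  then obtain n where n: "degree f = Suc n"
    by (metis not0_implies_Suc)
  have "of_nat (Suc n) * coeff f (Suc n) = 0"
    using assms(2) by (metis coeff_0 coeff_pderiv)
  moreover have "coeff f (Suc n) \<noteq> 0"
    using n by (metis leading_coeff_0_iff degree_0 nat.distinct(1))
  ultimately have "(of_nat (Suc n) :: 'a) = 0"
    by simp
  thus False
    using assms(1) by (simp only: of_nat_eq_0_iff_char_dvd) simp
qed

text \<open>Only exponents divisible by the characteristic survive a vanishing derivative.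
  Perfectness supplies roots of the coefficients, and the additivity of Frobenius assembles them
  into \<open>f0\<close>.\<close>

lemma pderiv_eq_0_imp_power_CHAR:
  fixes f :: "'a::field poly"
  assumes "perfect_field TYPE('a)" and p: "CHAR('a) > 0" and "pderiv f = 0"
  obtains f0 where "f = f0 ^ CHAR('a)"
proof -
  define p where "p = CHAR('a)"
  have "prime p"
    unfolding p_def using p by (rule prime_CHAR_semidom)
  hence p0: "p > 0"
    by (rule prime_gt_0_nat)
  have "surj (\<lambda>x::'a. x ^ p)"
    using assms(1) p by (simp add: perfect_field_def p_def)
  hence "\<exists>y::'a. y ^ p = x" for x
    by (metis surjD)
  then obtain rt :: "'a \<Rightarrow> 'a" where rt: "\<And>x. rt x ^ p = x"
    by metis
  have coeff0: "coeff f i = 0" if "\<not> p dvd i" for i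
  proof (cases i)
    case (Suc n)
    have "of_nat (Suc n) * coeff f (Suc n) = 0"
      using assms(3) by (metis coeff_0 coeff_pderiv)
    moreover have "(of_nat (Suc n) :: 'a) \<noteq> 0"
      using that Suc by (simp only: of_nat_eq_0_iff_char_dvd p_def) simp
    ultimately show ?thesis
      using Suc by simp
  qed (use that in simp)
  define f0 where "f0 = (\<Sum>j\<le>degree f. monom (rt (coeff f (p * j))) j)"
  have "f0 ^ p = (\<Sum>j\<le>degree f. monom (rt (coeff f (p * j))) j ^ p)"
    unfolding f0_def using \<open>prime p\<close> by (intro freshmans_dream_sum) (simp_all add: p_def)
  also have "\<dots> = (\<Sum>j\<le>degree f. monom (coeff f (p * j)) (p * j))"
    by (simp add: monom_power rt mult.commute)
  also have "\<dots> = f"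
  proof (rule poly_eqI)
    fix i
    have "coeff (\<Sum>j\<le>degree f. monom (coeff f (p * j)) (p * j)) i =
        (\<Sum>j\<le>degree f. if p * j = i then coeff f i else 0)"
      unfolding coeff_sum by (rule sum.cong) auto
    also have "\<dots> = coeff f i"
    proof (cases "p dvd i \<and> i \<le> degree f")
      case True
      then obtain k where k: "i = p * k"
        by auto
      have "k \<le> p * k"
        using p0 by simp
      hence "k \<in> {..degree f}"
        using True k by (simp only: atMost_iff) linarith
      have "(\<Sum>j\<le>degree f. if p * j = i then coeff f i else 0) =
          (\<Sum>j\<le>degree f. if j = k then coeff f i else 0)"
        using p0 k by (intro sum.cong) auto
      thus ?thesis
        using \<open>k \<in> _\<close> by simp
    next
      case False
      hence "coeff f i = 0"
        using coeff0 coeff_eq_0[of f i] by auto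
      thus ?thesis
        by (auto intro!: sum.neutral)
    qed
    finally show "coeff (\<Sum>j\<le>degree f. monom (coeff f (p * j)) (p * j)) i = coeff f i" .
  qed
  finally show ?thesis
    using that[of f0] by (simp add: p_def)
qed

text \<open>A generator of the annihilator ideal of \<open>\<alpha>\<close>, fixed only up to a
  nonzero scalar.\<close>

definition is_minpoly :: "'a::field alg_closure \<Rightarrow> 'a poly \<Rightarrow> bool" where
  "is_minpoly \<alpha> \<mu> \<longleftrightarrow> \<mu> \<noteq> 0 \<and> (\<forall>f. poly (pac f) \<alpha> = 0 \<longleftrightarrow> \<mu> dvd f)"

lemma minpoly_exists:
  obtains \<mu> where "is_minpoly \<alpha> \<mu>"
proof -
  define \<mu> where "\<mu> = arg_min degree (\<lambda>f. f \<noteq> 0 \<and> poly (pac f) \<alpha> = 0)"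
  obtain f0 where f0: "f0 \<noteq> 0 \<and> poly (pac f0) \<alpha> = 0"
    using alg_closure_algebraic[of \<alpha>] by blast
  have \<mu>: "\<mu> \<noteq> 0 \<and> poly (pac \<mu>) \<alpha> = 0"
    unfolding \<mu>_def by (rule arg_min_natI[where P = "\<lambda>f. f \<noteq> 0 \<and> poly (pac f) \<alpha> = 0", OF f0])
  have min: "degree \<mu> \<le> degree f" if "f \<noteq> 0 \<and> poly (pac f) \<alpha> = 0" for f
    unfolding \<mu>_def using that by (rule arg_min_nat_le[where P = "\<lambda>f. f \<noteq> 0 \<and> poly (pac f) \<alpha> = 0"])
  have "\<mu> dvd f" if "poly (pac f) \<alpha> = 0" for f
  proof -
    have "poly (pac (f mod \<mu>)) \<alpha> = 0"
      using that \<mu> by (simp add: minus_div_mult_eq_mod[symmetric])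
    hence "f mod \<mu> = 0"
      using min[of "f mod \<mu>"] degree_mod_less[of \<mu> f] \<mu> by (cases "f mod \<mu> = 0") auto
    thus ?thesis
      by (simp add: mod_eq_0_iff_dvd)
  qed
  moreover have "poly (pac f) \<alpha> = 0" if "\<mu> dvd f" for f
    using that \<mu> by (auto elim!: dvdE)
  ultimately show ?thesis
    using \<mu> that[of \<mu>] unfolding is_minpoly_def by blast
qed

lemma minpoly_root: "is_minpoly \<alpha> \<mu> \<Longrightarrow> poly (pac \<mu>) \<alpha> = 0"
  by (simp add: is_minpoly_def)

lemma degree_minpoly_pos:
  assumes "is_minpoly \<alpha> \<mu>"
  shows "degree \<mu> > 0"
proof (rule ccontr)
  assume "\<not> degree \<mu> > 0"
  then obtain c where "\<mu> = [:c:]"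
    by (auto elim: degree_eq_zeroE)
  thus False
    using assms minpoly_root[OF assms] by (simp add: is_minpoly_def map_poly_pCons)
qed

text \<open>Irreducibility in disguise: the minimal polynomial of \<open>\<beta>\<close> divides
  \<open>\<mu>\<close>, and the cofactor has too small a degree to vanish at
  \<open>\<alpha>\<close>.\<close>

lemma is_minpoly_conjugate:
  assumes \<mu>: "is_minpoly \<alpha> \<mu>" and \<beta>: "poly (pac \<mu>) \<beta> = 0"
  shows "is_minpoly \<beta> \<mu>"
proof -
  obtain \<nu> where \<nu>: "is_minpoly \<beta> \<nu>"
    using minpoly_exists .
  have "\<nu> dvd \<mu>"
    using \<beta> \<nu> by (simp add: is_minpoly_def)
  then obtain c where c: "\<mu> = \<nu> * c"
    by (elim dvdE)
  have nz: "\<mu> \<noteq> 0" "c \<noteq> 0" "\<nu> \<noteq> 0"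
    using \<mu> c by (auto simp: is_minpoly_def)
  have "poly (pac \<nu>) \<alpha> = 0 \<or> poly (pac c) \<alpha> = 0"
    using minpoly_root[OF \<mu>] by (simp add: c)
  moreover have False if "poly (pac c) \<alpha> = 0"
  proof -
    have "\<mu> dvd c"
      using that \<mu> by (simp add: is_minpoly_def)
    hence "degree \<mu> \<le> degree c"
      using nz by (intro dvd_imp_degree_le)
    thus False
      using degree_minpoly_pos[OF \<nu>] nz by (simp add: c degree_mult_eq)
  qed
  ultimately have "\<mu> dvd \<nu>"
    using \<mu> by (auto simp: is_minpoly_def)
  thus ?thesis
    using \<nu> \<open>\<nu> dvd \<mu>\<close> nz unfolding is_minpoly_def by (metis dvd_trans)
qed

text \<open>A vanishing derivative would make \<open>\<mu>\<close> a power of a polynomial of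
  smaller degree that also kills \<open>\<alpha>\<close>. So the derivative is nonzero, and a double
  root would force \<open>\<mu>\<close> to divide it, against the degrees.\<close>

lemma card_conjugates:
  fixes \<alpha> :: "'a::field alg_closure"
  assumes perf: "perfect_field TYPE('a)" and \<mu>: "is_minpoly \<alpha> \<mu>"
  shows "card {x. poly (pac \<mu>) x = 0} = degree \<mu>"
proof -
  have nz: "\<mu> \<noteq> 0"
    using \<mu> by (simp add: is_minpoly_def)
  have sep: "pderiv \<mu> \<noteq> 0"
  proof
    assume *: "pderiv \<mu> = 0"
    show False
    proof (cases "CHAR('a) = 0")
      case True
      thus False
        using pderiv_eq_0_CHAR_0[OF True *] degree_minpoly_pos[OF \<mu>] by simp
    next
      case False
      then obtain f where f: "\<mu> = f ^ CHAR('a)"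
        using pderiv_eq_0_imp_power_CHAR[OF perf _ *] by blast
      hence "poly (pac f) \<alpha> = 0"
        using minpoly_root[OF \<mu>] by simp
      hence "\<mu> dvd f"
        using \<mu> by (simp add: is_minpoly_def)
      moreover have "f \<noteq> 0"
        using f nz False by auto
      ultimately have "degree \<mu> \<le> degree f"
        by (intro dvd_imp_degree_le)
      moreover have "degree \<mu> = CHAR('a) * degree f"
        unfolding f using \<open>f \<noteq> 0\<close> by (simp add: degree_power_eq)
      moreover have "CHAR('a) > 1"
        using prime_gt_1_nat[OF prime_CHAR_semidom[where 'a = 'a]] False by simp
      ultimately show False
        using degree_minpoly_pos[OF \<mu>] by (cases "degree f = 0") auto
    qed
  qed
  have "order x (pac \<mu>) = 1" if "poly (pac \<mu>) x = 0" for x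
  proof -
    have "order x (pac \<mu>) > 0"
      using that nz by (simp add: order_gt_0_iff)
    moreover have "\<not> order x (pac \<mu>) \<ge> 2"
    proof
      assume "order x (pac \<mu>) \<ge> 2"
      hence "[:-x, 1:] ^ Suc 1 dvd pac \<mu>"
        using nz by (simp only: order_divides) simp
      hence "[:-x, 1:] ^ 1 dvd pderiv (pac \<mu>)"
        by (rule linear_power_dvd_pderiv)
      hence "poly (pac (pderiv \<mu>)) x = 0"
        by (simp add: pac_pderiv poly_eq_0_iff_dvd)
      hence "\<mu> dvd pderiv \<mu>"
        using is_minpoly_conjugate[OF \<mu> that] by (simp add: is_minpoly_def)
      hence "degree \<mu> \<le> degree (pderiv \<mu>)"
        using sep by (intro dvd_imp_degree_le)
      moreover have "degree (pderiv \<mu>) \<le> degree \<mu> - 1"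
        by (rule degree_pderiv_le)
      ultimately show False
        using degree_minpoly_pos[OF \<mu>] by linarith
    qed
    ultimately show ?thesis
      by linarith
  qed
  hence "(\<Sum>x | poly (pac \<mu>) x = 0. order x (pac \<mu>)) = card {x. poly (pac \<mu>) x = 0}"
    by simp
  thus ?thesis
    using sum_order_eq_degree[of "pac \<mu>"] nz by simp
qed

section \<open>Embeddings of subfields over the ground field\<close>

definition partial_hom :: "'a::field alg_closure set \<Rightarrow> ('a alg_closure \<Rightarrow> 'a alg_closure) \<Rightarrow> bool" where
  "partial_hom F \<phi> \<longleftrightarrow> range to_ac \<subseteq> F \<and> (\<forall>c. \<phi> (to_ac c) = to_ac c) \<and>
     (\<forall>x\<in>F. \<forall>y\<in>F. x + y \<in> F \<and> x * y \<in> F \<and> \<phi> (x + y) = \<phi> x + \<phi> y \<and> \<phi> (x * y) = \<phi> x * \<phi> y)"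

text \<open>
  No closure under inverses is required, since it is automatic in an algebraic extension.
\<close>

lemma inverse_eq_poly:
  fixes z :: "'a::field alg_closure"
  obtains q where "inverse z = poly (pac q) z"
proof (cases "z = 0")
  case True
  thus ?thesis
    using that[of 0] by simp
next
  case False
  obtain \<mu> where \<mu>: "is_minpoly z \<mu>"
    using minpoly_exists .
  obtain c q where q: "\<mu> = pCons c q"
    by (cases \<mu>)
  have eq: "to_ac c + z * poly (pac q) z = 0"
    using minpoly_root[OF \<mu>] by (simp add: q map_poly_pCons)
  have "c \<noteq> 0"
  proof
    assume "c = 0"
    hence "poly (pac q) z = 0"
      using eq False by simp
    hence "\<mu> dvd q"
      using \<mu> by (simp add: is_minpoly_def)
    moreover have "q \<noteq> 0"
      using \<mu> \<open>c = 0\<close> by (auto simp: q is_minpoly_def)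
    ultimately have "degree \<mu> \<le> degree q"
      by (intro dvd_imp_degree_le)
    thus False
      using \<open>q \<noteq> 0\<close> by (simp add: q)
  qed
  have "z * poly (pac q) z = - to_ac c"
    using eq by (simp add: eq_neg_iff_add_eq_0 add.commute)
  hence "to_ac (- inverse c) * (z * poly (pac q) z) = 1"
    using \<open>c \<noteq> 0\<close> by simp
  hence "z * poly (pac (smult (- inverse c) q)) z = 1"
    by (simp add: mult_ac del: smult_minus_left to_ac_minus to_ac_inverse)
  hence "inverse z = poly (pac (smult (- inverse c) q)) z"
    by (rule inverse_unique)
  thus ?thesis
    by (rule that)
qed

definition polys_over :: "'b::zero set \<Rightarrow> 'b poly set" where
  "polys_over F = {f. \<forall>i. coeff f i \<in> F}"

context
  fixes F :: "'a::field alg_closure set" and \<phi>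
  assumes hom: "partial_hom F \<phi>"
begin

lemma
  shows to_ac_in_hom: "to_ac c \<in> F" and hom_to_ac: "\<phi> (to_ac c) = to_ac c"
    and hom_add_closed: "x \<in> F \<Longrightarrow> y \<in> F \<Longrightarrow> x + y \<in> F"
    and hom_mult_closed: "x \<in> F \<Longrightarrow> y \<in> F \<Longrightarrow> x * y \<in> F"
    and hom_add: "x \<in> F \<Longrightarrow> y \<in> F \<Longrightarrow> \<phi> (x + y) = \<phi> x + \<phi> y"
    and hom_mult: "x \<in> F \<Longrightarrow> y \<in> F \<Longrightarrow> \<phi> (x * y) = \<phi> x * \<phi> y"
  using hom unfolding partial_hom_def by (blast intro: rangeI)+

lemma hom_0: "0 \<in> F" "\<phi> 0 = 0" and hom_1: "1 \<in> F" "\<phi> 1 = 1"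
  using to_ac_in_hom[of 0] hom_to_ac[of 0] to_ac_in_hom[of 1] hom_to_ac[of 1] by simp_all

lemma hom_uminus:
  assumes "x \<in> F"
  shows "- x \<in> F" "\<phi> (- x) = - \<phi> x"
  using hom_mult_closed[OF to_ac_in_hom[of "-1"] assms] hom_mult[OF to_ac_in_hom[of "-1"] assms]
    hom_to_ac[of "-1"] by simp_all

lemma hom_diff:
  assumes "x \<in> F" "y \<in> F"
  shows "x - y \<in> F" "\<phi> (x - y) = \<phi> x - \<phi> y"
  using hom_add_closed[OF assms(1) hom_uminus(1)[OF assms(2)]]
    hom_add[OF assms(1) hom_uminus(1)[OF assms(2)]] hom_uminus(2)[OF assms(2)] by simp_all

lemma hom_poly_pac:
  assumes "x \<in> F"
  shows "poly (pac f) x \<in> F" "\<phi> (poly (pac f) x) = poly (pac f) (\<phi> x)"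
proof -
  have "poly (pac f) x \<in> F \<and> \<phi> (poly (pac f) x) = poly (pac f) (\<phi> x)"
    using assms by (induction f)
      (simp_all add: map_poly_pCons hom_0 hom_add hom_mult hom_to_ac hom_add_closed hom_mult_closed to_ac_in_hom)
  thus "poly (pac f) x \<in> F" "\<phi> (poly (pac f) x) = poly (pac f) (\<phi> x)"
    by auto
qed

lemma hom_inverse_closed: "x \<in> F \<Longrightarrow> inverse x \<in> F"
  using inverse_eq_poly[of x] hom_poly_pac(1)[of x] by metis

lemma hom_inverse:
  assumes "x \<in> F"
  shows "\<phi> (inverse x) = inverse (\<phi> x)"
proof (cases "x = 0")
  case False
  hence "\<phi> x * \<phi> (inverse x) = 1"
    using hom_mult[OF assms hom_inverse_closed[OF assms]] by (simp add: hom_1)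
  thus ?thesis
    by (rule inverse_unique[symmetric])
qed (simp add: hom_0)

lemma hom_divide:
  assumes "x \<in> F" "y \<in> F"
  shows "x / y \<in> F" "\<phi> (x / y) = \<phi> x / \<phi> y"
  using assms by (simp_all add: divide_inverse hom_mult_closed hom_inverse_closed hom_mult hom_inverse)

lemma hom_eq_0_iff:
  assumes "x \<in> F"
  shows "\<phi> x = 0 \<longleftrightarrow> x = 0"
proof
  assume *: "\<phi> x = 0"
  show "x = 0"
  proof (rule ccontr)
    assume "x \<noteq> 0"
    hence "\<phi> (x * inverse x) = 1"
      by (simp add: hom_1)
    thus False
      using * hom_mult[OF assms hom_inverse_closed[OF assms]] by simp
  qed
qed (simp add: hom_0)

lemma inj_on_hom: "inj_on \<phi> F"
proof (rule inj_onI)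
  fix x y assume *: "x \<in> F" "y \<in> F" "\<phi> x = \<phi> y"
  hence "\<phi> (x - y) = 0"
    by (simp add: hom_diff)
  thus "x = y"
    using hom_eq_0_iff[of "x - y"] * by (simp add: hom_diff)
qed

lemma hom_sum:
  assumes "\<And>i. i \<in> I \<Longrightarrow> f i \<in> F"
  shows "sum f I \<in> F" "\<phi> (sum f I) = (\<Sum>i\<in>I. \<phi> (f i))"
proof -
  have "sum f I \<in> F \<and> \<phi> (sum f I) = (\<Sum>i\<in>I. \<phi> (f i))"
    using assms by (induction I rule: infinite_finite_induct)
      (simp_all add: hom_0 hom_add_closed hom_add)
  thus "sum f I \<in> F" "\<phi> (sum f I) = (\<Sum>i\<in>I. \<phi> (f i))"
    by auto
qed

lemma coeff_map_hom: "coeff (map_poly \<phi> f) i = \<phi> (coeff f i)"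
  by (simp add: coeff_map_poly hom_0)

lemma polys_over_ops:
  assumes "f \<in> polys_over F" "k \<in> polys_over F"
  shows "f + k \<in> polys_over F" "f - k \<in> polys_over F" "f * k \<in> polys_over F"
    "map_poly \<phi> (f + k) = map_poly \<phi> f + map_poly \<phi> k"
    "map_poly \<phi> (f - k) = map_poly \<phi> f - map_poly \<phi> k"
    "map_poly \<phi> (f * k) = map_poly \<phi> f * map_poly \<phi> k"
proof -
  have in_F: "coeff f i \<in> F" "coeff k i \<in> F" for i
    using assms by (auto simp: polys_over_def)
  have *: "coeff f i * coeff k j \<in> F" for i j
    by (intro hom_mult_closed in_F)
  show "f + k \<in> polys_over F" "f - k \<in> polys_over F" "f * k \<in> polys_over F"
    by (auto simp: polys_over_def coeff_mult in_F hom_add_closed hom_diff hom_sum *)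
  show "map_poly \<phi> (f + k) = map_poly \<phi> f + map_poly \<phi> k"
    by (rule poly_eqI) (simp add: coeff_map_hom in_F hom_add)
  show "map_poly \<phi> (f - k) = map_poly \<phi> f - map_poly \<phi> k"
    by (rule poly_eqI) (simp add: coeff_map_hom in_F hom_diff)
  show "map_poly \<phi> (f * k) = map_poly \<phi> f * map_poly \<phi> k"
    by (rule poly_eqI) (simp add: coeff_map_hom coeff_mult hom_sum * hom_mult in_F)
qed

lemma monom_in_polys_over: "c \<in> F \<Longrightarrow> monom c n \<in> polys_over F"
  by (simp add: polys_over_def hom_0)

lemma pac_in_polys_over: "pac f \<in> polys_over F"
  by (simp add: polys_over_def to_ac_in_hom)

text \<open>The extension to \<open>F[a]\<close> sends \<open>f(a)\<close> to the value at
  \<open>b\<close> of the transported polynomial; \<open>ann\<close> says exactly that this does not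
  depend on the choice of \<open>f\<close>.\<close>

lemma extend_partial_hom:
  assumes ann: "\<And>f. f \<in> polys_over F \<Longrightarrow> poly f a = 0 \<Longrightarrow> poly (map_poly \<phi> f) b = 0"
  shows "\<exists>F' \<phi>'. partial_hom F' \<phi>' \<and> F \<subseteq> F' \<and> a \<in> F' \<and> \<phi>' a = b \<and> (\<forall>x\<in>F. \<phi>' x = \<phi> x)"
proof -
  define F' where "F' = (\<lambda>f. poly f a) ` polys_over F"
  define rep where "rep z = (SOME f. f \<in> polys_over F \<and> poly f a = z)" for z
  define \<phi>' where "\<phi>' z = poly (map_poly \<phi> (rep z)) b" for z
  have \<phi>': "\<phi>' (poly f a) = poly (map_poly \<phi> f) b" if f: "f \<in> polys_over F" for f
  proof -
    have rep: "rep (poly f a) \<in> polys_over F \<and> poly (rep (poly f a)) a = poly f a"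
      unfolding rep_def by (rule someI[of _ f]) (use f in simp)
    hence "poly (map_poly \<phi> (rep (poly f a) - f)) b = 0"
      using f by (intro ann polys_over_ops) auto
    thus ?thesis
      using rep f by (simp add: \<phi>'_def polys_over_ops)
  qed
  have inc: "x \<in> F'" "\<phi>' x = \<phi> x" if "x \<in> F" for x
  proof -
    have 1: "[:x:] \<in> polys_over F"
      using monom_in_polys_over[OF that, of 0] by (simp add: monom_0)
    show "x \<in> F'"
      unfolding F'_def by (rule image_eqI[OF _ 1]) simp
    show "\<phi>' x = \<phi> x"
      using \<phi>'[OF 1] by (simp add: map_poly_pCons hom_0)
  qed
  have X: "[:0, 1:] \<in> polys_over F"
    using monom_in_polys_over[of 1 1] hom_1 by (simp add: monom_altdef)
  have "a \<in> F'"
    unfolding F'_def by (rule image_eqI[OF _ X]) simp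
  moreover have "\<phi>' a = b"
    using \<phi>'[OF X] by (simp add: map_poly_pCons hom_0 hom_1)
  moreover have "partial_hom F' \<phi>'"
    unfolding partial_hom_def
  proof (intro conjI ballI allI)
    show "range to_ac \<subseteq> F'"
      using inc(1) to_ac_in_hom by auto
    show "\<phi>' (to_ac c) = to_ac c" for c
      using inc(2)[OF to_ac_in_hom] by (simp add: hom_to_ac)
    fix x y assume "x \<in> F'" "y \<in> F'"
    then obtain f k where fk: "f \<in> polys_over F" "x = poly f a" "k \<in> polys_over F" "y = poly k a"
      by (auto simp: F'_def)
    show "x + y \<in> F'" unfolding F'_def
      by (rule image_eqI[OF _ polys_over_ops(1)[OF fk(1,3)]]) (simp add: fk)
    show "x * y \<in> F'" unfolding F'_def
      by (rule image_eqI[OF _ polys_over_ops(3)[OF fk(1,3)]]) (simp add: fk)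
    show "\<phi>' (x + y) = \<phi>' x + \<phi>' y"
      using \<phi>'[OF polys_over_ops(1)[OF fk(1,3)]] fk by (simp add: \<phi>' polys_over_ops)
    show "\<phi>' (x * y) = \<phi>' x * \<phi>' y"
      using \<phi>'[OF polys_over_ops(3)[OF fk(1,3)]] fk by (simp add: \<phi>' polys_over_ops)
  qed
  ultimately show ?thesis
    using inc by blast
qed

text \<open>\<open>b\<close> is a root of the transport of a least-degree annihilator
  \<open>m\<close> of \<open>a\<close> over \<open>F\<close>. Since \<open>\<phi>\<close> keeps the
  leading coefficient nonzero, that transport is not constant.\<close>

lemma partial_hom_root_exists:
  "\<exists>b. \<forall>f\<in>polys_over F. poly f a = 0 \<longrightarrow> poly (map_poly \<phi> f) b = 0"
proof -
  let ?P = "\<lambda>f. f \<in> polys_over F \<and> f \<noteq> 0 \<and> poly f a = 0"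
  obtain f0 where "f0 \<noteq> 0" "poly (pac f0) a = 0"
    using alg_closure_algebraic[of a] by blast
  hence P: "?P (pac f0)"
    by (simp add: pac_in_polys_over)
  define m where "m = arg_min degree ?P"
  have m: "?P m"
    unfolding m_def by (rule arg_min_natI[where P = ?P, OF P])
  have min: "degree m \<le> degree f" if "?P f" for f
    unfolding m_def using that by (rule arg_min_nat_le[where P = ?P])
  have lead: "lead_coeff m \<in> F" "lead_coeff m \<noteq> 0"
    using m by (auto simp: polys_over_def)
  have "degree m > 0"
    using m by (cases "degree m = 0") (auto elim: degree_eq_zeroE)
  moreover have "coeff (map_poly \<phi> m) (degree m) \<noteq> 0"
    using lead by (simp add: coeff_map_hom hom_eq_0_iff)
  hence "degree m \<le> degree (map_poly \<phi> m)"
    by (rule le_degree)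
  ultimately obtain b where b: "poly (map_poly \<phi> m) b = 0"
    using alg_closed_imp_poly_has_root[of "map_poly \<phi> m"] by auto
  \<comment> \<open>Long division by \<open>m\<close>, one leading term at a time, by induction on a
    degree bound \<open>n\<close>: \<open>F\<close> is a set and not a type, so each intermediate
    polynomial has to be shown to have coefficients in \<open>F\<close>.\<close>
  have "poly (map_poly \<phi> f) b = 0"
    if "f \<in> polys_over F" "poly f a = 0" "f = 0 \<or> degree f < n" for f n
    using that
  proof (induction n arbitrary: f)
    case (Suc n)
    show ?case
    proof (cases "f = 0")
      case False
      hence deg: "degree m \<le> degree f"
        using Suc.prems by (intro min) auto
      define c where "c = lead_coeff f / lead_coeff m"
      have c: "c \<in> F"
        unfolding c_def using lead Suc.prems(1) by (intro hom_divide) (auto simp: polys_over_def)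
      define k where "k = monom c (degree f - degree m)"
      have k: "k \<in> polys_over F"
        unfolding k_def by (rule monom_in_polys_over[OF c])
      define f' where "f' = f - k * m"
      have km: "k * m \<in> polys_over F"
        using k m by (intro polys_over_ops) auto
      have f': "f' \<in> polys_over F"
        unfolding f'_def by (intro polys_over_ops Suc.prems km)
      have "degree (k * m) \<le> degree f"
        using degree_mult_le[of k m] degree_monom_le[of c "degree f - degree m"] deg
        unfolding k_def by linarith
      hence "degree f' \<le> degree f"
        unfolding f'_def by (intro degree_diff_le) auto
      moreover have "coeff f' (degree f) = 0"
      proof -
        have "coeff (k * m) (degree f - degree m + degree m) = c * lead_coeff m"
          unfolding k_def using degree_monom_le[of c] by (subst coeff_mult_top) auto
        thus ?thesis
          using deg lead by (simp add: f'_def c_def)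
      qed
      ultimately have "f' = 0 \<or> degree f' < n"
        using Suc.prems(3) False by (metis leading_coeff_0_iff less_Suc_eq_le le_neq_implies_less less_le_trans)
      hence "poly (map_poly \<phi> f') b = 0"
        using Suc.prems m by (intro Suc.IH f') (auto simp: f'_def)
      moreover have "map_poly \<phi> f' = map_poly \<phi> f - map_poly \<phi> k * map_poly \<phi> m"
        unfolding f'_def using Suc.prems(1) km k m by (simp add: polys_over_ops)
      ultimately show ?thesis
        using b by simp
    qed simp
  qed auto
  thus ?thesis
    by (metis lessI)
qed

end

text \<open>Only finitely many preimages have to be conjugated at a time, so finite induction does
  the work of an automorphism of the whole algebraic closure.\<close>

lemma partial_hom_extend_finite:
  assumes "finite Y" "partial_hom F \<phi>"
  shows "\<exists>F' \<phi>'. partial_hom F' \<phi>' \<and> F \<union> Y \<subseteq> F' \<and> (\<forall>x\<in>F. \<phi>' x = \<phi> x)"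
  using assms
proof (induction Y rule: finite_induct)
  case empty
  thus ?case
    by auto
next
  case (insert y Y)
  then obtain F1 \<phi>1 where 1: "partial_hom F1 \<phi>1" "F \<union> Y \<subseteq> F1" "\<forall>x\<in>F. \<phi>1 x = \<phi> x"
    by blast
  obtain b where "\<forall>f\<in>polys_over F1. poly f y = 0 \<longrightarrow> poly (map_poly \<phi>1 f) b = 0"
    using partial_hom_root_exists[OF 1(1)] by blast
  hence "\<exists>F' \<phi>'. partial_hom F' \<phi>' \<and> F1 \<subseteq> F' \<and> y \<in> F' \<and> \<phi>' y = b \<and> (\<forall>x\<in>F1. \<phi>' x = \<phi>1 x)"
    by (intro extend_partial_hom[OF 1(1)]) blast
  then obtain F' \<phi>' where 2: "partial_hom F' \<phi>'" "F1 \<subseteq> F'" "y \<in> F'" "\<forall>x\<in>F1. \<phi>' x = \<phi>1 x"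
    by blast
  have "F \<union> insert y Y \<subseteq> F'" "\<forall>x\<in>F. \<phi>' x = \<phi> x"
    using 1 2 by auto
  with 2(1) show ?case
    by blast
qed

lemma partial_hom_range_to_ac: "partial_hom (range to_ac) (\<lambda>x. x)"
  unfolding partial_hom_def by (auto simp flip: to_ac_add to_ac_mult)

lemma conjugating_hom_exists:
  assumes \<mu>: "is_minpoly \<alpha> \<mu>" "poly (pac \<mu>) \<beta> = 0" and "finite Y"
  obtains F \<phi> where "partial_hom F \<phi>" "\<alpha> \<in> F" "Y \<subseteq> F" "\<phi> \<alpha> = \<beta>"
proof -
  note hom = partial_hom_range_to_ac
  have "poly (map_poly (\<lambda>x. x) f) \<beta> = 0" if f: "f \<in> polys_over (range to_ac)" "poly f \<alpha> = 0" for f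
  proof -
    have "f = pac (map_poly of_ac f)"
      using f(1) by (intro poly_eqI) (auto simp: polys_over_def coeff_map_poly to_ac_of_ac)
    moreover from this have "\<mu> dvd map_poly of_ac f"
      using f(2) \<mu>(1) by (metis is_minpoly_def)
    ultimately show ?thesis
      using is_minpoly_conjugate[OF \<mu>] by (metis is_minpoly_def map_poly_id')
  qed
  from extend_partial_hom[OF hom this] obtain F0 \<phi>0 where
    0: "partial_hom F0 \<phi>0" "\<alpha> \<in> F0" "\<phi>0 \<alpha> = \<beta>"
    by blast
  obtain F \<phi> where "partial_hom F \<phi>" "F0 \<union> Y \<subseteq> F" "\<forall>x\<in>F0. \<phi> x = \<phi>0 x"
    using partial_hom_extend_finite[OF assms(3) 0(1)] by blast
  thus ?thesis
    using 0 that[of F \<phi>] by auto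
qed

lemma partial_hom_ratmap:
  assumes hom: "partial_hom F \<phi>" and t: "set_option t \<subseteq> F"
  shows "set_option (ratmap_ac G H \<delta> t) \<subseteq> F"
    and "ratmap_ac G H \<delta> (map_option \<phi> t) = map_option \<phi> (ratmap_ac G H \<delta> t)"
proof -
  have *: "set_option (proj_pt u v) \<subseteq> F \<and> proj_pt (\<phi> u) (\<phi> v) = map_option \<phi> (proj_pt u v)"
    if "u \<in> F" "v \<in> F" for u v
    using that by (auto simp: proj_pt_def hom_eq_0_iff[OF hom] hom_divide[OF hom])
  have 1: "set_option (proj_pt (to_ac (coeff G \<delta>)) (to_ac (coeff H \<delta>))) \<subseteq> F \<and>
      proj_pt (to_ac (coeff G \<delta>)) (to_ac (coeff H \<delta>)) =
      map_option \<phi> (proj_pt (to_ac (coeff G \<delta>)) (to_ac (coeff H \<delta>)))"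
    using *[OF to_ac_in_hom[OF hom] to_ac_in_hom[OF hom], of "coeff G \<delta>" "coeff H \<delta>"]
    by (simp add: hom_to_ac[OF hom])
  show "set_option (ratmap_ac G H \<delta> t) \<subseteq> F"
    using t * 1 by (cases t) (auto simp: ratmap_def hom_poly_pac[OF hom])
  show "ratmap_ac G H \<delta> (map_option \<phi> t) = map_option \<phi> (ratmap_ac G H \<delta> t)"
    using t * 1 by (cases t) (auto simp: ratmap_def hom_poly_pac[OF hom] simp flip: hom_poly_pac(2)[OF hom])
qed

lemma partial_hom_ratmap_funpow:
  assumes hom: "partial_hom F \<phi>" and t: "set_option t \<subseteq> F"
  shows "set_option ((ratmap_ac G H \<delta> ^^ n) t) \<subseteq> F"
    and "(ratmap_ac G H \<delta> ^^ n) (map_option \<phi> t) = map_option \<phi> ((ratmap_ac G H \<delta> ^^ n) t)"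
proof -
  have "set_option ((ratmap_ac G H \<delta> ^^ n) t) \<subseteq> F \<and>
    (ratmap_ac G H \<delta> ^^ n) (map_option \<phi> t) = map_option \<phi> ((ratmap_ac G H \<delta> ^^ n) t)"
  proof (induction n)
    case (Suc n)
    thus ?case
      using partial_hom_ratmap[OF hom, of "(ratmap_ac G H \<delta> ^^ n) t" G H \<delta>] by simp
  qed (use t in simp)
  thus "set_option ((ratmap_ac G H \<delta> ^^ n) t) \<subseteq> F"
    and "(ratmap_ac G H \<delta> ^^ n) (map_option \<phi> t) = map_option \<phi> ((ratmap_ac G H \<delta> ^^ n) t)"
    by auto
qed

section \<open>The degree of a simple extension\<close>

lemma field_adjoin_eq: "field_adjoin \<alpha> = range (\<lambda>f. poly (pac f) \<alpha>)"
proof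
  let ?F = "range (\<lambda>f. poly (pac f) \<alpha>)"
  have "to_ac c \<in> ?F" for c
    by (rule range_eqI[of _ _ "[:c:]"]) (simp add: map_poly_pCons)
  moreover have "\<alpha> \<in> ?F"
    by (rule range_eqI[of _ _ "[:0, 1:]"]) (simp add: map_poly_pCons)
  moreover have "x + y \<in> ?F" "x * y \<in> ?F" if xy: "x \<in> ?F" "y \<in> ?F" for x y
  proof -
    obtain f k where "x = poly (pac f) \<alpha>" "y = poly (pac k) \<alpha>"
      using xy by blast
    thus "x + y \<in> ?F" "x * y \<in> ?F"
      by (simp_all flip: poly_add poly_mult pac_add pac_mult)
  qed
  ultimately have "partial_hom ?F (\<lambda>x. x)" "\<alpha> \<in> ?F"
    unfolding partial_hom_def by blast+
  note hom = this(1) and \<open>\<alpha> \<in> ?F\<close>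
  have "range to_ac \<subseteq> ?F"
    using to_ac_in_hom[OF hom] by blast
  moreover have "x + y \<in> ?F \<and> x - y \<in> ?F \<and> x * y \<in> ?F \<and> x / y \<in> ?F"
    if xy: "x \<in> ?F" "y \<in> ?F" for x y
    by (intro conjI hom_add_closed[OF hom] hom_diff(1)[OF hom] hom_mult_closed[OF hom]
      hom_divide(1)[OF hom] xy)
  ultimately show "field_adjoin \<alpha> \<subseteq> ?F"
    unfolding field_adjoin_def using \<open>\<alpha> \<in> ?F\<close> by (intro Inter_lower CollectI conjI ballI) blast+
  show "?F \<subseteq> field_adjoin \<alpha>"
    unfolding field_adjoin_def
  proof (intro Inter_greatest image_subsetI)
    fix f F assume "F \<in> {F. range to_ac \<subseteq> F \<and> \<alpha> \<in> F \<and>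
     (\<forall>x\<in>F. \<forall>y\<in>F. x + y \<in> F \<and> x - y \<in> F \<and> x * y \<in> F \<and> x / y \<in> F)}"
    hence F: "range to_ac \<subseteq> F" "\<alpha> \<in> F" "\<And>x y. x \<in> F \<Longrightarrow> y \<in> F \<Longrightarrow> x + y \<in> F"
      "\<And>x y. x \<in> F \<Longrightarrow> y \<in> F \<Longrightarrow> x * y \<in> F"
      by auto
    have "to_ac c \<in> F" for c
      using F(1) by auto
    with F show "poly (pac f) \<alpha> \<in> F"
      by (induction f) (auto simp: map_poly_pCons simp flip: to_ac_0)
  qed
qed

lemma ext_degree_eq_degree_minpoly:
  assumes \<mu>: "is_minpoly \<alpha> \<mu>"
  shows "ext_degree \<alpha> = degree \<mu>"
proof -
  interpret V: vector_space "\<lambda>c x. to_ac c * x :: 'a alg_closure"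
    by unfold_locales (auto simp: algebra_simps)
  let ?n = "degree \<mu>" and ?b = "\<lambda>i. \<alpha> ^ i"
  have small: "f = 0" if "poly (pac f) \<alpha> = 0" "degree f < ?n" for f
  proof (rule ccontr)
    assume "f \<noteq> 0"
    hence "?n \<le> degree f"
      using \<mu> that(1) by (intro dvd_imp_degree_le) (auto simp: is_minpoly_def)
    with that(2) show False
      by simp
  qed
  have lin: "u i = 0" if "(\<Sum>i<?n. to_ac (u i) * \<alpha> ^ i) = 0" "i < ?n" for u i
  proof -
    define f where "f = (\<Sum>i<?n. monom (u i) i)"
    have cf: "coeff f j = (if j < ?n then u j else 0)" for j
    proof -
      have "coeff f j = (\<Sum>i<?n. if i = j then u i else 0)"
        unfolding f_def coeff_sum by (rule sum.cong) auto
      thus ?thesis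
        by simp
    qed
    have "poly (pac f) \<alpha> = 0"
      using that(1) by (simp add: f_def pac_sum poly_sum map_poly_monom poly_monom)
    moreover have "degree f < ?n"
    proof -
      have "degree f \<le> ?n - 1"
        by (rule degree_le) (auto simp: cf)
      thus ?thesis
        using degree_minpoly_pos[OF \<mu>] by linarith
    qed
    ultimately have "f = 0"
      by (rule small)
    thus ?thesis
      using cf[of i] that(2) by simp
  qed
  have inj: "inj_on ?b {..<?n}"
  proof (rule inj_onI)
    fix i j assume ij: "i \<in> {..<?n}" "j \<in> {..<?n}" "\<alpha> ^ i = \<alpha> ^ j"
    show "i = j"
    proof (rule ccontr)
      assume "i \<noteq> j"
      \<comment> \<open>Two equal powers would give a relation with coefficient 1 at
        \<open>i\<close>. Injectivity ensures that the set of powers really has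
        \<open>degree \<mu>\<close> elements.\<close>
      define u :: "nat \<Rightarrow> 'a" where "u l = (if l = i then 1 else 0) - (if l = j then 1 else 0)" for l
      have "to_ac (u l) * \<alpha> ^ l = (if l = i then \<alpha> ^ l else 0) - (if l = j then \<alpha> ^ l else 0)" for l
        by (simp add: u_def)
      hence "(\<Sum>l<?n. to_ac (u l) * \<alpha> ^ l) = \<alpha> ^ i - \<alpha> ^ j"
        using ij by (simp add: sum_subtractf)
      hence "u i = 0"
        using ij lin[of u i] by simp
      thus False
        using \<open>i \<noteq> j\<close> by (simp add: u_def)
    qed
  qed
  have "V.dim (field_adjoin \<alpha>) = ?n"
  proof (rule V.dim_unique)
    show "?b ` {..<?n} \<subseteq> field_adjoin \<alpha>"
      unfolding field_adjoin_eq
    proof (rule image_subsetI)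
      show "\<alpha> ^ i \<in> range (\<lambda>f. poly (pac f) \<alpha>)" for i
        by (rule range_eqI[of _ _ "monom 1 i"]) (simp add: map_poly_monom poly_monom)
    qed
    show "V.independent (?b ` {..<?n})"
    proof (rule V.independent_if_scalars_zero)
      fix f x assume "(\<Sum>x\<in>?b ` {..<?n}. to_ac (f x) * x) = 0" "x \<in> ?b ` {..<?n}"
      then obtain i where i: "i < ?n" "x = \<alpha> ^ i" and
        "(\<Sum>i<?n. to_ac (f (\<alpha> ^ i)) * \<alpha> ^ i) = 0"
        by (auto simp: sum.reindex[OF inj])
      thus "f x = 0"
        using lin[of "\<lambda>i. f (\<alpha> ^ i)" i] by simp
    qed simp
    show "card (?b ` {..<?n}) = ?n"
      using card_image[OF inj] by simp
    show "field_adjoin \<alpha> \<subseteq> V.span (?b ` {..<?n})"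
      unfolding field_adjoin_eq
    proof (rule image_subsetI)
      fix f
      have nz: "\<mu> \<noteq> 0"
        using \<mu> by (simp add: is_minpoly_def)
      have "poly (pac f) \<alpha> = poly (pac (f div \<mu> * \<mu> + f mod \<mu>)) \<alpha>"
        by simp
      also have "\<dots> = poly (pac (f mod \<mu>)) \<alpha>"
        unfolding pac_add pac_mult poly_add poly_mult minpoly_root[OF \<mu>] by simp
      also have "\<dots> = (\<Sum>i\<le>degree (f mod \<mu>). to_ac (coeff (f mod \<mu>) i) * \<alpha> ^ i)"
        by (simp add: poly_altdef)
      also have "\<dots> \<in> V.span (?b ` {..<?n})"
      proof (intro V.span_sum V.span_scale V.span_base imageI)
        fix i assume "i \<in> {..degree (f mod \<mu>)}"
        thus "i \<in> {..<?n}"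
          using degree_mod_less[OF nz, of f] degree_minpoly_pos[OF \<mu>] by auto
      qed
      finally show "poly (pac f) \<alpha> \<in> V.span (?b ` {..<?n})" .
    qed
  qed
  thus ?thesis
    by (simp add: ext_degree_def)
qed

section \<open>The separable part of a rational function\<close>

lemma pderiv_eq_0_if_wronskian_eq_0:
  fixes g h :: "'a::field poly"
  assumes "coprime g h" "pderiv g * h = g * pderiv h"
  shows "pderiv g = 0"
proof -
  obtain a b where "a * g + b * h = 1"
    using field_poly_bezout[OF assms(1)] .
  \<comment> \<open>With the vanishing Wronskian, the Bezout identity makes \<open>g\<close> a
    divisor of its own derivative, which for degree reasons is then 0.\<close>
  hence "pderiv g = (a * g + b * h) * pderiv g"
    by simp
  also have "\<dots> = a * g * pderiv g + b * (pderiv g * h)"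
    by (simp add: algebra_simps)
  also have "\<dots> = g * (a * pderiv g + b * pderiv h)"
    unfolding assms(2) by (simp add: algebra_simps)
  finally have "g dvd pderiv g"
    by (rule dvdI)
  show ?thesis
  proof (rule ccontr)
    assume nz: "pderiv g \<noteq> 0"
    hence "degree g \<le> degree (pderiv g)"
      using \<open>g dvd pderiv g\<close> by (intro dvd_imp_degree_le)
    moreover have "degree (pderiv g) \<le> degree g - 1"
      by (rule degree_pderiv_le)
    ultimately have "degree g = 0"
      by linarith
    thus False
      using nz by (auto elim!: degree_eq_zeroE simp: pderiv_pCons)
  qed
qed

text \<open>A vanishing Wronskian kills both derivatives. In positive characteristic perfectness
  then makes \<open>g\<close>, \<open>h\<close> and hence \<open>Rt\<close> powers, which a
  $p$-reduction is not.\<close>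

lemma wronskian_nonzero:
  fixes R Rt :: "'a::field poly fract"
  assumes perf: "perfect_field TYPE('a)" and red: "is_p_reduction R Rt"
    and Rt: "Rt = Fract g h" "h \<noteq> 0" "coprime g h" and deg: "max (degree g) (degree h) > 0"
  shows "pderiv g * h - g * pderiv h \<noteq> 0"
proof
  assume "pderiv g * h - g * pderiv h = 0"
  hence "pderiv g = 0" "pderiv h = 0"
    using pderiv_eq_0_if_wronskian_eq_0[of g h] pderiv_eq_0_if_wronskian_eq_0[of h g] Rt(3)
    by (simp_all add: coprime_commute mult.commute)
  show False
  proof (cases "CHAR('a) = 0")
    case True
    thus False
      using deg pderiv_eq_0_CHAR_0[OF True] \<open>pderiv g = 0\<close> \<open>pderiv h = 0\<close> by simp
  next
    case False
    obtain g0 where g0: "g = g0 ^ CHAR('a)"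
      using pderiv_eq_0_imp_power_CHAR[OF perf _ \<open>pderiv g = 0\<close>] False by blast
    obtain h0 where h0: "h = h0 ^ CHAR('a)"
      using pderiv_eq_0_imp_power_CHAR[OF perf _ \<open>pderiv h = 0\<close>] False by blast
    have "h0 \<noteq> 0"
      using Rt(2) h0 False by auto
    hence "Rt = Fract g0 h0 ^ CHAR('a)"
      by (simp add: Rt(1) g0 h0 Fract_power)
    thus False
      using red False by (auto simp: is_p_reduction_def)
  qed
qed

text \<open>\<open>q\<close> is a power of the characteristic, or 1 in characteristic 0. Injectivity
  comes from the additivity of Frobenius, surjectivity from algebraic closedness.\<close>

lemma p_reduction_power:
  fixes R Rt :: "'a::field poly fract"
  assumes "is_p_reduction R Rt"
  obtains q where "q > 0" "R = Rt ^ q" "bij (\<lambda>x::'a alg_closure. x ^ q)"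
proof (cases "CHAR('a) = 0")
  case True
  thus ?thesis
    using assms that[of 1] by (simp add: is_p_reduction_def bij_betw_def)
next
  case False
  then obtain k where k: "R = Rt ^ (CHAR('a) ^ k)"
    using assms by (auto simp: is_p_reduction_def)
  let ?q = "CHAR('a) ^ k"
  have prime: "prime CHAR('a alg_closure)"
    using prime_CHAR_semidom[where 'a = 'a] False by simp
  have "inj (\<lambda>x::'a alg_closure. x ^ ?q)"
  proof (rule injI)
    fix x y :: "'a alg_closure" assume eq: "x ^ ?q = y ^ ?q"
    have "((x - y) + y) ^ ?q = (x - y) ^ ?q + y ^ ?q"
      by (rule freshmans_dream'[OF prime, where n = k]) simp
    thus "x = y"
      using eq by simp
  qed
  moreover have "surj (\<lambda>x::'a alg_closure. x ^ ?q)"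
    unfolding surj_def using nth_root_exists[of ?q] False by (metis zero_less_power neq0_conv)
  ultimately show ?thesis
    using that[of ?q] k False by (simp add: bij_def)
qed

lemma ratmap_power:
  assumes "u \<noteq> 0" "q > 0" "degree g \<le> d" "degree h \<le> d"
  shows "ratmap_ac (smult u (g ^ q)) (smult u (h ^ q)) (q * d) t =
    map_option (\<lambda>x. x ^ q) (ratmap_ac g h d t)"
  using assms
  by (cases t) (auto simp: ratmap_def proj_pt_def power_divide coeff_power_top)


lemma rational_dynamics:
  fixes R Rt :: "'a::field poly fract"
  assumes perf: "perfect_field TYPE('a)"
    and R: "R = Fract G H" "H \<noteq> 0" "coprime G H"
    and red: "is_p_reduction R Rt"
    and Rt: "Rt = Fract g h" "h \<noteq> 0" "coprime g h"
    and d: "d = rat_degree Rt" "d > 1"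
  shows "represents R G H (rat_degree R)"
    and "represents Rt g h d"
    and "ramified_map (ratmap_ac G H (rat_degree R)) (ramif (pac g) (pac h) d) d"
    and "finite Y \<Longrightarrow> None \<notin> Y \<Longrightarrow>
      sum (ramif (pac g) (pac h) d) Y \<le> degree (pderiv g * h - g * pderiv h)"
    and "degree (pderiv g * h - g * pderiv h) \<le> 2 * d - 2"
proof -
  have d_max: "d = max (degree g) (degree h)"
    using rat_degree_Fract[OF Rt] d by simp
  show rep: "represents Rt g h d"
    using Rt d d_max by (simp add: represents_def)
  interpret T: rational_map "pac g" "pac h" d
    by (rule rational_map_pac[OF rep])
  define W where "W = pderiv g * h - g * pderiv h"
  have pacW: "pderiv (pac g) * pac h - pac g * pderiv (pac h) = pac W"
    by (simp add: W_def pac_pderiv)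
  have "W \<noteq> 0"
    unfolding W_def using wronskian_nonzero[OF perf red Rt] d d_max by simp
  hence W0: "pderiv (pac g) * pac h - pac g * pderiv (pac h) \<noteq> 0"
    by (simp add: pacW)
  show "finite Y \<Longrightarrow> None \<notin> Y \<Longrightarrow> sum (ramif (pac g) (pac h) d) Y \<le> degree (pderiv g * h - g * pderiv h)"
    using T.sum_ramif_le(1)[OF W0] by (simp add: pacW W_def[symmetric])
  show "degree (pderiv g * h - g * pderiv h) \<le> 2 * d - 2"
    using T.degree_wronskian_le_2d by (simp add: pacW W_def[symmetric])
  obtain q where q: "q > 0" "R = Rt ^ q" "bij (\<lambda>x::'a alg_closure. x ^ q)"
    using p_reduction_power[OF red] .
  have "coprime (g ^ q) (h ^ q)"
    using q(1) T.no_common_root by (intro coprime_if_no_common_root) auto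
  moreover have "Fract (g ^ q) (h ^ q) = Fract G H"
    using q(2) Rt R(1) by (simp add: Fract_power)
  ultimately obtain u where u: "u \<noteq> 0" "G = smult u (g ^ q)" "H = smult u (h ^ q)"
    using Fract_coprime_unique[of "g ^ q" "h ^ q" G H] R Rt by auto
  have degs: "degree g \<le> d" "degree h \<le> d"
    by (simp_all add: d_max)
  have "q * d = max (degree (g ^ q)) (degree (h ^ q))"
    using T.top degs by (intro max_degree_eqI degree_power_le') (auto simp: coeff_power_top)
  hence degR: "rat_degree R = q * d"
    using rat_degree_Fract[OF R] u by simp
  show "represents R G H (rat_degree R)"
    using rat_degree_Fract[OF R] R degR q d by (simp add: represents_def)
  define frob :: "'a alg_closure option \<Rightarrow> 'a alg_closure option" where "frob = map_option (\<lambda>x. x ^ q)"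
  have "bij frob"
    using q(3) unfolding frob_def bij_def by (simp add: option.inj_map surj_def) (metis map_option_eq_Some not_None_eq option.map_disc_iff)
  have S: "ratmap_ac G H (rat_degree R) = frob \<circ> ratmap_ac g h d"
    unfolding degR u frob_def using ratmap_power[OF u(1) q(1) degs] by auto
  \<comment> \<open>Each fibre of \<open>R\<close> is a fibre of the separable map over another
    point, so all fibre counts carry over with \<open>d\<close> in place of the degree
    \<open>q * d\<close> of \<open>R\<close>.\<close>
  have fibre: "ratmap_ac G H (rat_degree R) -` {t} = ratmap_ac g h d -` {inv_into UNIV frob t}" for t
    unfolding S using \<open>bij frob\<close> by (auto simp: bij_inv_eq_iff)
  show "ramified_map (ratmap_ac G H (rat_degree R)) (ramif (pac g) (pac h) d) d"
  proof
    show "sum (ramif (pac g) (pac h) d) Y \<le> 2 * d - 2" if "finite Y" for Y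
      using T.sum_ramif_le(2)[OF W0 that] .
  qed (use d(2) in \<open>auto simp only: fibre T.finite_vimage_ratmap T.card_vimage_ratmap T.vimage_ratmap_nonempty\<close>)
qed

subsection \<open>The counting theorem\<close>

text \<open>Embeddings over $K$ inject the preimages of either point into those of the other, so the
  counts agree; \<open>card_pre_Suc\<close> then determines \<open>ram\<close>. No invariance of
  \<open>\<rho>\<close> itself under conjugation is required.\<close>

lemma ram_conjugate:
  fixes \<alpha> :: "'a::field alg_closure"
  assumes "ramified_map (ratmap_ac G H \<delta>) \<rho> d"
    and \<mu>: "is_minpoly \<alpha> \<mu>" and \<beta>: "poly (pac \<mu>) \<beta> = 0"
  shows "ramified_map.ram (ratmap_ac G H \<delta>) \<rho> (Suc n) (Some \<beta>) =
      ramified_map.ram (ratmap_ac G H \<delta>) \<rho> (Suc n) (Some \<alpha>)"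
proof -
  interpret ramified_map "ratmap_ac G H \<delta>" \<rho> d
    by fact
  have le: "card (pre n (Some x)) \<le> card (pre n (Some y))"
    if x: "is_minpoly x \<mu>" and y: "poly (pac \<mu>) y = 0" for x y n
  proof -
    define Y where "Y = (\<Union>t\<in>pre n (Some x). set_option t)"
    have "finite Y"
      unfolding Y_def by (intro finite_UN_I) auto
    then obtain F \<phi> where hom: "partial_hom F \<phi>" "x \<in> F" "Y \<subseteq> F" "\<phi> x = y"
      using conjugating_hom_exists[OF x y] by blast
    have in_F: "set_option t \<subseteq> F" if "t \<in> pre n (Some x)" for t
      using that hom(3) by (auto simp: Y_def)
    show ?thesis
    proof (rule card_inj_on_le)
      show "inj_on (map_option \<phi>) (pre n (Some x))"
      proof (rule inj_onI)
        fix s t assume st: "s \<in> pre n (Some x)" "t \<in> pre n (Some x)" "map_option \<phi> s = map_option \<phi> t"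
        thus "s = t"
          using in_F[OF st(1)] in_F[OF st(2)] inj_onD[OF inj_on_hom[OF hom(1)]]
          by (cases s; cases t) auto
      qed
      show "map_option \<phi> ` pre n (Some x) \<subseteq> pre n (Some y)"
        using partial_hom_ratmap_funpow(2)[OF hom(1) in_F] hom(4) by (auto simp: pre_def)
    qed simp
  qed
  have card: "card (pre n (Some \<beta>)) = card (pre n (Some \<alpha>))" for n
    using le[OF \<mu> \<beta>, of n] le[OF is_minpoly_conjugate[OF \<mu> \<beta>] minpoly_root[OF \<mu>], of n] by simp
  show "ram (Suc n) (Some \<beta>) = ram (Suc n) (Some \<alpha>)"
    using card_pre_Suc[of n "Some \<alpha>"] card_pre_Suc[of n "Some \<beta>"] card[of n] card[of "Suc n"] by simp
qed

text \<open>Conjugating the given \<open>k\<close>-step path provides every conjugate with a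
  conjugate \<open>k\<close> steps before it. A backward chain from \<open>\<alpha>\<close> inside
  the finite set \<open>C\<close> must repeat, and a point lying on two levels makes
  \<open>\<alpha>\<close> periodic.\<close>

lemma periodic_if_conjugate_reachable:
  fixes \<alpha> :: "'a::field alg_closure"
  assumes "ramified_map (ratmap_ac G H \<delta>) \<rho> d"
    and \<mu>: "is_minpoly \<alpha> \<mu>" and \<beta>: "poly (pac \<mu>) \<beta> = 0" and \<gamma>: "poly (pac \<mu>) \<gamma> = 0"
    and k: "k \<ge> 1" "(ratmap_ac G H \<delta> ^^ k) (Some \<beta>) = Some \<gamma>"
  shows "ramified_map.periodic (ratmap_ac G H \<delta>) (Some \<alpha>)"
proof -
  interpret ramified_map "ratmap_ac G H \<delta>" \<rho> d
    by fact
  let ?S = "ratmap_ac G H \<delta>"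
  define C where "C = {x. poly (pac \<mu>) x = 0}"
  have "finite C"
    unfolding C_def using \<mu> by (intro poly_roots_finite) (simp add: is_minpoly_def)
  have step: "\<exists>y\<in>C. (?S ^^ k) (Some y) = Some x" if x: "x \<in> C" for x
  proof -
    obtain F \<phi> where hom: "partial_hom F \<phi>" "{\<beta>} \<subseteq> F" "\<phi> \<gamma> = x"
      using conjugating_hom_exists[OF is_minpoly_conjugate[OF \<mu> \<gamma>], of x "{\<beta>}"] x
      unfolding C_def by blast
    have "(?S ^^ k) (Some (\<phi> \<beta>)) = Some x"
      using partial_hom_ratmap_funpow(2)[OF hom(1), of "Some \<beta>" k G H \<delta>] hom k(2) by simp
    moreover have "\<phi> \<beta> \<in> C"
      using hom_poly_pac(2)[OF hom(1), of \<beta> \<mu>] hom(2) \<beta> by (simp add: C_def hom_0[OF hom(1)])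
    ultimately show ?thesis
      by blast
  qed
  have "\<exists>y\<in>C. Some y \<in> pre (k * m) (Some \<alpha>)" for m
  proof (induction m)
    case 0
    show ?case
      using minpoly_root[OF \<mu>] by (auto simp: C_def)
  next
    case (Suc m)
    then obtain y where y: "y \<in> C" "Some y \<in> pre (k * m) (Some \<alpha>)"
      by blast
    obtain z where z: "z \<in> C" "(?S ^^ k) (Some z) = Some y"
      using step[OF y(1)] by blast
    have "(?S ^^ (k * m + k)) (Some z) = (?S ^^ (k * m)) (Some y)"
      by (simp add: funpow_add z)
    hence "Some z \<in> pre (k * Suc m) (Some \<alpha>)"
      using y(2) by (simp add: pre_def add.commute)
    with z(1) show ?case
      by blast
  qed
  then obtain f where f: "\<And>m. f m \<in> C" "\<And>m. Some (f m) \<in> pre (k * m) (Some \<alpha>)"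
    by metis
  have "\<not> inj f"
    using f(1) \<open>finite C\<close> by (metis finite_imageD finite_subset image_subsetI infinite_UNIV_nat)
  then obtain i j where "i < j" "f i = f j"
    unfolding inj_def by (metis linorder_neqE_nat)
  hence "(?S ^^ (k * j - k * i)) (Some \<alpha>) = Some \<alpha>"
    using pre_overlap[OF f(2)[of i], of "k * j" "Some \<alpha>"] f(2)[of j] by simp
  moreover have "k * j - k * i \<ge> 1"
    using k(1) \<open>i < j\<close> by (simp add: Suc_le_eq)
  ultimately show ?thesis
    unfolding periodic_def by blast
qed

theorem theorem2p2:
  fixes R Rt :: "'a::field poly fract" and G H g h W :: "'a poly"
    and \<alpha> :: "'a alg_closure" and d d' e :: nat
  assumes "perfect_field TYPE('a)"
    and "R = Fract G H" and "H \<noteq> 0" and "coprime G H"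
    and "is_p_reduction R Rt"
    and "Rt = Fract g h" and "h \<noteq> 0" and "coprime g h"
    and "d = rat_degree Rt" and "d > 1"
    and "W = pderiv g * h - g * pderiv h" and "d' = degree W"
    and "\<not> R_critical R \<alpha>"
    and "e = ext_degree \<alpha>"
  shows "\<exists>c::real. 0 < c \<and> c \<le> 1 \<and>
    (\<exists>C::real. \<forall>n. \<bar>real (Delta \<alpha> R n) - c * real d ^ n\<bar> \<le> C) \<and>
    (\<not> R_periodic R \<alpha> \<longrightarrow>
       c \<ge> 1 / real d ^ 2 - 1 / real d ^ 3 \<and>
       (e > 1 \<longrightarrow>
          c \<ge> 1 - real d' / (real d * real e) \<and>
          1 - real d' / (real d * real e) \<ge> 1 / real d) \<and>
       (e = 1 \<and> \<not> (\<exists>\<gamma>. to_ac \<gamma> \<in> reversed_orbit R \<alpha> \<and>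
                      degree (G - smult \<gamma> H) < rat_degree R) \<longrightarrow>
          c \<ge> 1 - min (real d - 1) (real d') / real d
                - (real d' - min (real d - 1) (real d')) / real d ^ 2 \<and>
          1 - min (real d - 1) (real d') / real d
            - (real d' - min (real d - 1) (real d')) / real d ^ 2 \<ge> 1 / real d ^ 2)) \<and>
    (R_periodic R \<alpha> \<longrightarrow>
       c \<ge> 1 / (4 * real d ^ 2) \<and>
       (e > 2 \<longrightarrow>
          c \<ge> 1 - real d' / (real e * (real d - 1)) \<and>
          1 - real d' / (real e * (real d - 1)) \<ge> 1 / 3) \<and>
       (e = 2 \<longrightarrow> c \<ge> 1 / real d ^ 2 - 1 / real d ^ 3))"
proof -
  define S where "S = ratmap_ac G H (rat_degree R)"
  define \<rho> where "\<rho> = ramif (pac g) (pac h) d"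
  note dyn = rational_dynamics[OF assms(1-10)]
  have repR: "represents R G H (rat_degree R)"
    by (rule dyn(1))
  have fin_bound: "sum \<rho> Y \<le> d'" if "finite Y" "None \<notin> Y" for Y
    using dyn(4)[OF that] assms(11,12) by (simp add: \<rho>_def)
  have d'_le: "d' \<le> 2 * d - 2"
    using dyn(5) assms(11,12) by simp
  have ram_map: "ramified_map S \<rho> d"
    using dyn(3) by (simp add: S_def \<rho>_def)
  interpret ramified_map S \<rho> d
    by (rule ram_map)
  have d: "real d \<ge> 2" "real d' \<le> 2 * real d - 2"
    using d_ge_2 d'_le by linarith+
  let ?a = "Some \<alpha>"
  define c where "c = growth ?a"
  have iter: "rat_has_value (rat_iter R n) x y \<longleftrightarrow> (S ^^ n) (Some x) = Some y" for n x y
    unfolding S_def by (rule rat_iter_has_value_iff[OF repR])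
  \<comment> \<open>\<open>Delta\<close> counts finite points only, so it can differ from the count
    on the projective line by the single point \<open>None\<close>.\<close>
  have pre_img: "pre n ?a = Some ` iter_preimages R n \<alpha> \<union> (if None \<in> pre n ?a then {None} else {})" for n
  proof (rule Set.set_eqI)
    fix t
    show "t \<in> pre n ?a \<longleftrightarrow> t \<in> Some ` iter_preimages R n \<alpha> \<union> (if None \<in> pre n ?a then {None} else {})"
      by (cases t) (auto simp: pre_def iter_preimages_def iter)
  qed
  have fin: "finite (iter_preimages R n \<alpha>)" for n
    using finite_subset[of "Some ` iter_preimages R n \<alpha>" "pre n ?a"] pre_img[of n]
    by (metis Un_upper1 finite_imageD finite_pre inj_Some)
  have card_pre: "card (pre n ?a) = Delta \<alpha> R n + (if None \<in> pre n ?a then 1 else 0)" for n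
  proof -
    have "card (pre n ?a) = card (Some ` iter_preimages R n \<alpha>) + card (if None \<in> pre n ?a then {None :: 'a alg_closure option} else {})"
      by (subst pre_img, subst card_Un_disjoint) (auto simp: fin)
    thus ?thesis
      by (simp add: card_image Delta_def)
  qed
  have unb: "\<exists>n. card (pre n ?a) > M" for M
  proof (rule ccontr)
    assume "\<not> ?thesis"
    hence "card (pre n ?a) \<le> M" for n
      by (simp add: not_less)
    hence "Delta \<alpha> R n \<le> M" for n
      using card_pre[of n] by (metis add_leD1)
    hence "R_critical R \<alpha>"
      unfolding R_critical_def using fin by (auto intro!: bdd_aboveI[of _ M])
    with assms(13) show False
      by contradiction
  qed
  have per: "R_periodic R \<alpha> \<longleftrightarrow> periodic ?a"
    by (simp add: R_periodic_def periodic_def iter)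
  have c_ge: "c \<ge> 1 / real d ^ 2 - 1 / real d ^ 3"
    unfolding c_def using growth_ge[OF unb] .
  have quarter: "1 / real d ^ 2 - 1 / real d ^ 3 \<ge> 1 / (4 * real d ^ 2)"
    using d(1) by (simp add: field_simps power3_eq_cube power2_eq_square)
  have c_pos: "c > 0"
    using d(1) by (intro less_le_trans[OF _ order.trans[OF quarter c_ge]]) simp
  \<comment> \<open>The constant is 2 from the projective count plus 1 for the point at
    infinity.\<close>
  have asymp: "\<bar>real (Delta \<alpha> R n) - c * real d ^ n\<bar> \<le> 3" for n
    using card_pre_asymp[of n ?a] card_pre[of n] unfolding c_def by (auto split: if_splits)

  obtain \<mu> where \<mu>: "is_minpoly \<alpha> \<mu>"
    using minpoly_exists .
  define C where "C = {x. poly (pac \<mu>) x = 0}"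
  have e: "e = degree \<mu>" "card C = e"
    using ext_degree_eq_degree_minpoly[OF \<mu>] card_conjugates[OF assms(1) \<mu>] assms(14)
    by (simp_all add: C_def)
  have finC: "finite C"
    using e degree_minpoly_pos[OF \<mu>] by (intro card_ge_0_finite) simp
  have \<alpha>C: "\<alpha> \<in> C"
    using minpoly_root[OF \<mu>] by (simp add: C_def)
  have same_ram: "ram (Suc n) (Some \<beta>) = ram (Suc n) ?a" if "\<beta> \<in> C" for \<beta> n
    using ram_conjugate[OF ram_map[unfolded S_def] \<mu>, of \<beta> n] that by (simp add: S_def C_def)
  \<comment> \<open>\<open>S\<close> has coefficients in $K$, so every finite point in the forward
    orbit of infinity lies in $K$, whereas a conjugate of \<open>\<alpha>\<close> has degree
    \<open>e > 1\<close>.\<close>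
  have no_infty: "None \<notin> pre n (Some \<beta>)" if "e > 1" "\<beta> \<in> C" for n \<beta>
  proof
    assume "None \<in> pre n (Some \<beta>)"
    hence "(S ^^ n) None = Some \<beta>"
      by (simp add: pre_def)
    hence "\<beta> \<in> range to_ac"
      using partial_hom_ratmap_funpow(1)[OF partial_hom_range_to_ac, of None n G H "rat_degree R"]
      by (simp add: S_def)
    then obtain b where b: "\<beta> = to_ac b"
      by blast
    have "poly (pac [:- b, 1:]) \<beta> = 0"
      by (simp add: b map_poly_pCons)
    hence "\<mu> dvd [:- b, 1:]"
      using is_minpoly_conjugate[OF \<mu>, of \<beta>] that(2) unfolding C_def is_minpoly_def by blast
    hence "degree \<mu> \<le> 1"
      using dvd_imp_degree_le[of \<mu> "[:- b, 1:]"] by simp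
    with that(1) e show False
      by simp
  qed
  \<comment> \<open>For fixed \<open>m\<close> the preimages of the \<open>e\<close> conjugates are
    disjoint, avoid infinity and carry equal ramification, so the bound \<open>d'\<close> is shared
    among them.\<close>
  have ram_conj: "real (ram (Suc m) ?a) \<le> real d' / real e" if "e > 1" for m
  proof -
    have "e * ram (Suc m) ?a = (\<Sum>\<beta>\<in>C. ram (Suc m) (Some \<beta>))"
      using same_ram e by simp
    also have "\<dots> = sum \<rho> (\<Union>\<beta>\<in>C. pre (Suc m) (Some \<beta>))"
      unfolding ram_def using finC pre_disjoint by (subst sum.UNION_disjoint) auto
    also have "\<dots> \<le> d'"
      using finC no_infty[OF that] by (intro fin_bound) auto
    finally have "real (e * ram (Suc m) ?a) \<le> real d'"
      by (rule of_nat_mono)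
    thus ?thesis
      using that by (simp add: field_simps)
  qed

  have case_1a: "c \<ge> 1 - real d' / (real d * real e)" if "e > 1" and np: "\<not> periodic ?a"
  proof -
    have "(\<Sum>m<n. real (ram (Suc m) ?a)) \<le> real d' / real e" for n
    proof -
      let ?P = "\<lambda>(\<beta>, m). pre (Suc m) (Some \<beta>)"
      \<comment> \<open>Across different levels, overlap would let one conjugate reach another in a
        positive number of steps and so make \<open>\<alpha>\<close> periodic.\<close>
      have disj: "?P x \<inter> ?P y = {}" if xy: "x \<in> C \<times> {..<n}" "y \<in> C \<times> {..<n}" "x \<noteq> y" for x y
      proof -
        have *: "pre (Suc i) (Some \<beta>) \<inter> pre (Suc j) (Some \<gamma>) = {}"
          if "i < j" "\<beta> \<in> C" "\<gamma> \<in> C" for i j \<beta> \<gamma>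
        proof (rule ccontr)
          assume "\<not> ?thesis"
          then obtain x where "x \<in> pre (Suc i) (Some \<beta>)" "x \<in> pre (Suc j) (Some \<gamma>)"
            by blast
          hence "(S ^^ (Suc j - Suc i)) (Some \<beta>) = Some \<gamma>"
            using that by (intro pre_overlap) auto
          hence "periodic ?a"
            using periodic_if_conjugate_reachable[OF ram_map[unfolded S_def] \<mu>, of \<beta> \<gamma> "j - i"] that
            by (simp add: S_def C_def)
          with np show False
            by contradiction
        qed
        obtain \<beta> i \<gamma> j where eqs: "x = (\<beta>, i)" "y = (\<gamma>, j)"
          by (cases x, cases y)
        show ?thesis
          using *[of i j \<beta> \<gamma>] *[of j i \<gamma> \<beta>] pre_disjoint[of "Some \<beta>" "Some \<gamma>" "Suc i"] xy
          unfolding eqs by (cases i j rule: linorder_cases) auto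
      qed
      have "e * (\<Sum>m<n. ram (Suc m) ?a) = (\<Sum>\<beta>\<in>C. \<Sum>m<n. ram (Suc m) (Some \<beta>))"
        using same_ram e by simp
      also have "\<dots> = (\<Sum>x\<in>C \<times> {..<n}. sum \<rho> (?P x))"
        by (simp add: sum.cartesian_product ram_def case_prod_unfold)
      also have "\<dots> = sum \<rho> (\<Union>x\<in>C \<times> {..<n}. ?P x)"
        using finC disj by (subst sum.UNION_disjoint) auto
      also have "\<dots> \<le> d'"
        using finC no_infty[OF \<open>e > 1\<close>] by (intro fin_bound) auto
      finally have "real (e * (\<Sum>m<n. ram (Suc m) ?a)) \<le> real d'"
        by (rule of_nat_mono)
      thus ?thesis
        using \<open>e > 1\<close> by (simp add: field_simps)
    qed
    from growth_ge_of_bounded_sum(1)[OF this] show ?thesis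
      by (simp add: c_def mult.commute)
  qed

  have case_1a': "1 - real d' / (real d * real e) \<ge> 1 / real d" if "e > 1"
  proof -
    have "real d' / (real d * real e) \<le> (2 * real d - 2) / (real d * 2)"
      using that d by (intro frac_le mult_left_mono) auto
    also have "\<dots> = 1 - 1 / real d"
      using d by (simp add: field_simps)
    finally show ?thesis
      by simp
  qed

  have case_1b: "c \<ge> 1 - min (real d - 1) (real d') / real d
      - (real d' - min (real d - 1) (real d')) / real d ^ 2"
    if np: "\<not> periodic ?a" and no\<gamma>: "\<not> (\<exists>\<gamma>. to_ac \<gamma> \<in> reversed_orbit R \<alpha> \<and>
                      degree (G - smult \<gamma> H) < rat_degree R)"
  proof -
    interpret R: rational_map "pac G" "pac H" "rat_degree R"
      by (rule rational_map_pac[OF repR])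
    \<comment> \<open>If infinity were in the backward orbit, its image would be a finite point of
      $K$ (a fixed infinity never reaches \<open>\<alpha>\<close>) in the reversed orbit. Being the
      value at infinity means that the fibre polynomial over it drops in degree, which
      \<open>no\<gamma>\<close> forbids.\<close>
    have "None \<notin> pre (Suc m) ?a" for m
    proof
      assume "None \<in> pre (Suc m) ?a"
      hence m: "(S ^^ m) (S None) = ?a"
        by (simp add: pre_def funpow_swap1)
      have "S None \<noteq> None"
      proof
        assume *: "S None = None"
        hence "(S ^^ m) None = None"
          by (induction m) auto
        with m * show False
          by simp
      qed
      then obtain \<gamma> where \<gamma>: "S None = Some (to_ac \<gamma>)"
        by (auto simp: S_def ratmap_def proj_pt_def simp flip: to_ac_divide split: if_splits)
      have "degree (fibre_poly (pac G) (pac H) (Some (to_ac \<gamma>))) < rat_degree R"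
        using \<gamma> by (simp add: S_def R.ratmap_None_eq_iff)
      also have "fibre_poly (pac G) (pac H) (Some (to_ac \<gamma>)) = pac (G - smult \<gamma> H)"
        by (simp add: fibre_poly_def)
      finally have "degree (G - smult \<gamma> H) < rat_degree R"
        by (simp only: degree_pac)
      moreover have "to_ac \<gamma> \<in> reversed_orbit R \<alpha>"
        using m \<gamma> by (auto simp: reversed_orbit_def iter_preimages_def iter)
      ultimately show False
        using no\<gamma> by blast
    qed
    hence none: "None \<notin> pre m ?a" if "m \<ge> 1" for m
      using that by (cases m) auto
    have "(\<Sum>m<n. real (ram (Suc m) ?a)) \<le> real d'" for n
      by (rule sum_ram_nonperiodic_le[OF np fin_bound]) (use none in auto)
    from growth_ge_of_bounded_sum(2)[OF this] show ?thesis
      by (simp add: c_def)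
  qed

  have case_1b': "1 - min (real d - 1) (real d') / real d
      - (real d' - min (real d - 1) (real d')) / real d ^ 2 \<ge> 1 / real d ^ 2"
  proof -
    define M where "M = min (real d - 1) (real d')"
    have "(real d - 1) * (real d - 1 - M) \<ge> 0"
      using d unfolding M_def by (intro mult_nonneg_nonneg) auto
    hence "M * real d + (real d' - M) \<le> real d ^ 2 - 1"
      using d by (simp add: algebra_simps power2_eq_square)
    hence "(M * real d + (real d' - M)) / real d ^ 2 \<le> (real d ^ 2 - 1) / real d ^ 2"
      by (intro divide_right_mono) auto
    moreover have "(M * real d + (real d' - M)) / real d ^ 2 = M / real d + (real d' - M) / real d ^ 2"
      using d by (simp add: add_divide_distrib power2_eq_square)
    moreover have "(real d ^ 2 - 1) / real d ^ 2 = 1 - 1 / real d ^ 2"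
      using d by (simp add: diff_divide_distrib)
    ultimately show ?thesis
      unfolding M_def[symmetric] by linarith
  qed

  have case_2a: "c \<ge> 1 - real d' / (real e * (real d - 1))" if "e > 2"
    using growth_ge_of_bounded[of ?a "real d' / real e", OF ram_conj] that by (simp add: c_def)
  have case_2a': "1 - real d' / (real e * (real d - 1)) \<ge> 1 / 3" if "e > 2"
  proof -
    have "real d' / (real e * (real d - 1)) \<le> (2 * real d - 2) / (3 * (real d - 1))"
      using that d by (intro frac_le mult_right_mono) auto
    also have "\<dots> = 2 / 3"
      using d by (simp add: field_simps)
    finally show ?thesis
      by simp
  qed

  have bounded: "\<exists>B::real. \<forall>n. \<bar>real (Delta \<alpha> R n) - c * real d ^ n\<bar> \<le> B"
    using asymp by blast
  have c_le_1: "c \<le> 1"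
    unfolding c_def by (rule growth_le_1)
  \<comment> \<open>The uniform bound \<open>c_ge\<close> serves both the first claim of (1) and
    (2)(b), and through \<open>quarter\<close> also the first claim of (2).\<close>
  show ?thesis
    unfolding per
    by (rule exI[of _ c], intro conjI impI bounded c_pos c_le_1 c_ge case_1a case_1a' case_1b'
      case_2a case_2a' order.trans[OF quarter c_ge]; (elim conjE)?; (rule case_1b)?; assumption)
qed

end
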